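(* Let $n\ge 2$ be an integer. Then: (a) $\mathrm{Aut}_{PL}(A_n(\mathbf{R}))=\mathrm{Aut}_{PL}(B_n(\mathbf{R}))$; (b) $\mathrm{Out}_{PL}(A_n(\mathbf{R}))\simeq \langle\!\langle n\rangle\!\rangle/\langle n\rangle$; (c) $\mathrm{Out}_{PL}(B_n(\mathbf{R}))\simeq \mathbf{Z}_{n-1}\rtimes \langle\!\langle n\rangle\!\rangle/\langle n\rangle$.
   Context: Functions are written to the right of their arguments and composed from left to right. For an integer $n\ge 2$: $\mathbf{Z}[\frac1n]=\{an^b : a,b\in\mathbf{Z}\}$; $\langle n\rangle=\{n^k : k\in\mathbf{Z}\}$ (a multiplicative group); $\langle\!\langle n\rangle\!\rangle$ is the multiplicative subgroup of $\mathbf{Q}^*$ generated by the prime divisors of $n$. A break of a piecewise linear (PL) function is a point where its derivative is discontinuous. $A_n(\mathbf{R})$ is the group of all homeomorphisms $h:\mathbf{R}\to\mathbf{R}$ such that (1) $h$ preserves orientation, (2) $h$ is PL, (3) all slopes of $h$ are in $\langle n\rangle$, (4) the breaks of $h$ lie in a discrete subset of $\mathbf{Z}[\frac1n]$, (5) $(\mathbf{Z}[\frac1n])h=\mathbf{Z}[\frac1n]$. Let $\phi_n:\mathbf{Z}[\frac1n]\to\mathbf{Z}_{n-1}=\mathbf{Z}/(n-1)\mathbf{Z}$ be the well-defined surjective ring homomorphism $(an^b)\phi_n=a \pmod{n-1}$. There is a well-defined homomorphism $\rho_n:A_n(\mathbf{R})\to\mathbf{Z}_{n-1}$, $f\rho_n=(xf)\phi_n-x\phi_n$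 for any $x\in\mathbf{Z}[\frac1n]$, and $B_n(\mathbf{R})=\ker\rho_n$. Every automorphism of $C=A_n(\mathbf{R})$ or $C=B_n(\mathbf{R})$ is conjugation $f\mapsto h^{-1}fh$ by a unique self homeomorphism $h$ of $\mathbf{R}$, so $\mathrm{Aut}(C)$ is identified with the normalizer of $C$ in $\mathrm{Homeo}(\mathbf{R})$, and $C$ with the group of inner automorphisms. $\mathrm{Aut}_{PL}(C)$ is the subgroup of those automorphisms whose homeomorphism $h$ is PL and orientation preserving, and $\mathrm{Out}_{PL}(C)=\mathrm{Aut}_{PL}(C)/C$ is its image in $\mathrm{Out}(C)$. In (c), the coset $s\langle n\rangle$, $s\in\langle\!\langle n\rangle\!\rangle\subset\mathbf{Z}[\frac1n]$, acts on $\mathbf{Z}_{n-1}$ by multiplication by the unit $s\phi_n$. *)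

theory Defs
  imports
    "HOL-Analysis.Analysis"
    "HOL-Algebra.Elementary_Groups"
    "HOL-Algebra.Zassenhaus"
    "HOL-Computational_Algebra.Primes"
begin

definition Z_inv :: "nat \<Rightarrow> real set" where
  "Z_inv n = {of_int a * real n powi b | a b. True}"

definition powers_group :: "nat \<Rightarrow> real set" where
  "powers_group n = {real n powi k | k. True}"

text \<open>The multiplicative group of the rationals, as a subset of the reals, so that its elements
  are at the same time slopes and elements of \<open>Z_inv n\<close>.\<close>

definition rat_units :: "real monoid" where
  "rat_units = \<lparr>carrier = \<rat> - {0}, monoid.mult = (*), one = 1\<rparr>"

definition prime_divisors_group :: "nat \<Rightarrow> real set" where
  "prime_divisors_group n = generate rat_units {real p | p. Factorial_Ring.prime p \<and> p dvd n}"

definition prime_divisors_quotient :: "nat \<Rightarrow> real set monoid" where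
  "prime_divisors_quotient n =
     (rat_units\<lparr>carrier := prime_divisors_group n\<rparr>) Mod (powers_group n)"

text \<open>Functions act on the right: the product of \<open>f\<close> and \<open>g\<close> is ``first \<open>f\<close>, then \<open>g\<close>''.\<close>

definition HomeoR :: "(real \<Rightarrow> real) monoid" where
  "HomeoR = \<lparr>carrier = {f. \<exists>g. homeomorphism UNIV UNIV f g},
             monoid.mult = (\<lambda>f g. g \<circ> f), one = id\<rparr>"

text \<open>As usual, the linear pieces of a PL function are locally finite.\<close>

definition PL :: "(real \<Rightarrow> real) \<Rightarrow> bool" where
  "PL f \<longleftrightarrow> continuous_on UNIV f \<and>
     (\<exists>B. (\<forall>a b. finite (B \<inter> {a..b})) \<and>
          (\<forall>a b. {a<..<b} \<inter> B = {} \<longrightarrow> (\<exists>m c. \<forall>x\<in>{a<..<b}. f x = m * x + c)))"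

text \<open>The first conjunct is needed because \<open>deriv f\<close> has an unspecified value where \<open>f\<close> is not
  differentiable.\<close>

definition breaks :: "(real \<Rightarrow> real) \<Rightarrow> real set" where
  "breaks f = {x. \<not> ((\<forall>\<^sub>F y in nhds x. f differentiable (at y)) \<and> isCont (deriv f) x)}"

definition slopes :: "(real \<Rightarrow> real) \<Rightarrow> real set" where
  "slopes f = {m. \<exists>x. (f has_real_derivative m) (at x)}"

definition A_R :: "nat \<Rightarrow> (real \<Rightarrow> real) set" where
  "A_R n = {h \<in> carrier HomeoR.
     strict_mono h \<and> PL h \<and> slopes h \<subseteq> powers_group n \<and>
     (\<exists>D. discrete D \<and> D \<subseteq> Z_inv n \<and> breaks h \<subseteq> D) \<and>
     h ` Z_inv n = Z_inv n}"

definition phi :: "nat \<Rightarrow> real \<Rightarrow> int" where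
  "phi n x = (THE r. \<exists>a b. x = of_int a * real n powi b \<and> r = a mod int (n - 1))"

definition rho :: "nat \<Rightarrow> (real \<Rightarrow> real) \<Rightarrow> int" where
  "rho n f = (THE r. \<forall>x\<in>Z_inv n. r = (phi n (f x) - phi n x) mod int (n - 1))"

definition B_R :: "nat \<Rightarrow> (real \<Rightarrow> real) set" where
  "B_R n = kernel (HomeoR\<lparr>carrier := A_R n\<rparr>) (integer_mod_group (n - 1)) (rho n)"

text \<open>An automorphism of \<open>C\<close> (for \<open>C\<close> one of \<open>A_R n\<close>, \<open>B_R n\<close>) is identified with the unique
  homeomorphism \<open>h\<close> such that the automorphism is conjugation by \<open>h\<close>; so \<open>Aut C\<close> is the normalizer
  of \<open>C\<close> in \<open>HomeoR\<close>, and \<open>C\<close> itself is the group of inner automorphisms.\<close>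

definition Aut_PL :: "(real \<Rightarrow> real) set \<Rightarrow> (real \<Rightarrow> real) set" where
  "Aut_PL C = {h \<in> normalizer HomeoR C. PL h \<and> strict_mono h}"

definition Out_PL :: "(real \<Rightarrow> real) set \<Rightarrow> (real \<Rightarrow> real) set monoid" where
  "Out_PL C = (HomeoR\<lparr>carrier := Aut_PL C\<rparr>) Mod C"

definition coset_action :: "nat \<Rightarrow> real set \<Rightarrow> int \<Rightarrow> int" where
  "coset_action n S a = (THE r. \<exists>s\<in>S. r = (phi n s * a) mod int (n - 1))"

definition semidirect_product ::
    "('a, 'm) monoid_scheme \<Rightarrow> ('b, 'k) monoid_scheme \<Rightarrow> ('b \<Rightarrow> 'a \<Rightarrow> 'a) \<Rightarrow> ('a \<times> 'b) monoid" where
  "semidirect_product N Q act =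
     \<lparr>carrier = carrier N \<times> carrier Q,
      monoid.mult = (\<lambda>(a, s) (b, t). (a \<otimes>\<^bsub>N\<^esub> act s b, s \<otimes>\<^bsub>Q\<^esub> t)),
      one = (\<one>\<^bsub>N\<^esub>, \<one>\<^bsub>Q\<^esub>)\<rparr>"

end

theory Submission
  imports Defs "HOL-Number_Theory.Cong"
begin

text \<open>
  Write \<open>Z\<close> for the ring \<open>\<int>[1/n]\<close>, \<open>A\<close> and \<open>B\<close> for the two groups, and \<open>\<langle>n\<rangle>\<close> for the group of powers
  of \<open>n\<close>. The proof finds one explicit group \<open>N\<close> that is the PL normalizer of \<open>A\<close> and of \<open>B\<close>, and
  one surjective homomorphism from \<open>N\<close> onto the semidirect product whose kernel is \<open>B\<close>.

  The group \<open>N\<close> consists of the increasing PL homeomorphisms \<open>h\<close> that map \<open>Z\<close> onto itself, have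
  their breaks in \<open>Z\<close>, and for which there is a positive unit \<open>s\<close> of \<open>Z\<close> such that all slopes
  of \<open>s h\<close> are powers of \<open>n\<close>. The positive units of \<open>Z\<close> are exactly the products of powers of prime
  divisors of \<open>n\<close> (lemma \<open>prime_divisors_group_iff_unit\<close>), and \<open>s = 1\<close> gives \<open>A\<close>.

  A PL map normalizing \<open>A\<close> or \<open>B\<close> lies in \<open>N\<close> (lemma \<open>scaled_A_if_normalizes\<close>), and two kinds of
  elements of \<open>B\<close> suffice to see this. For \<open>x \<in> Z\<close>, the map that is the identity on the left of \<open>x\<close>
  and has slope \<open>n\<close> on the right is in \<open>B\<close>; its conjugate by \<open>h\<close> has a break at \<open>h x\<close> and lies in
  \<open>A\<close>, so \<open>h x \<in> Z\<close>. The translations by elements of \<open>(n - 1) Z\<close> are in \<open>B\<close> and carry any point into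
  any given interval; conjugation by \<open>h\<close> turns them into elements of \<open>A\<close>, so near every point
  outside \<open>Z\<close> the map \<open>h\<close> is affine like on one fixed interval, up to a factor in \<open>\<langle>n\<rangle>\<close> of the slope.
  The slope on that interval is a unit since \<open>h\<close> and its inverse preserve \<open>Z\<close>.

  Conversely, let \<open>h \<in> N\<close> with constant \<open>s\<close>. As \<open>\<phi> p\<close> is \<open>1\<close> modulo \<open>n - 1\<close> for \<open>p \<in> \<langle>n\<rangle>\<close>, the residue
  \<open>\<phi> (s h(x)) - \<phi> x\<close> is the same at all \<open>x \<in> Z\<close> (lemma \<open>phi_scaled_A\<close>). This residue, which
  is \<open>\<phi> (s h(0))\<close>, and the coset \<open>s\<langle>n\<rangle>\<close> are the two components of the homomorphism from \<open>N\<close> to the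
  semidirect product. The maps \<open>x \<mapsto> (x + a) / s\<close> show that it is surjective. Its kernel is \<open>B\<close>,
  and the kernel of its second component is \<open>A\<close>. So \<open>A\<close> and \<open>B\<close> are normal in \<open>N\<close>, which is thus
  contained in both normalizers, and the two quotients come from the first isomorphism theorem.
\<close>

section \<open>Quotients and normalizers\<close>

text \<open>The image of a group under a homomorphism is a group. So a map onto the semidirect product
  that respects the operations also proves that the semidirect product is a group.\<close>

lemma (in group) iso_quotient_of_surjective_hom:
  assumes hom: "f \<in> hom G H" and onto: "f ` carrier G = carrier H" and one: "f \<one> = \<one>\<^bsub>H\<^esub>"
  shows "kernel G H f \<lhd> G" "G Mod kernel G H f \<cong> H"
proof -
  have "H\<lparr>carrier := f ` carrier G, one := f \<one>\<rparr> = H" by (simp add: onto one)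
  then have "group H" using hom_imp_img_group[OF hom] by simp
  then interpret group_hom G H f
    using hom is_group by (simp add: group_hom_def group_hom_axioms_def)
  show "kernel G H f \<lhd> G" by (rule normal_kernel)
  show "G Mod kernel G H f \<cong> H" by (rule FactGroup_iso[OF onto])
qed

lemma (in group) mem_normalizer_iff:
  assumes "C \<subseteq> carrier G"
  shows "h \<in> normalizer G C \<longleftrightarrow> h \<in> carrier G \<and> h <# C #> inv h = C"
  using assms by (auto simp: normalizer_def stabilizer_def)

lemma (in group) normal_subset_normalizer:
  assumes "subgroup N G" "C \<lhd> G\<lparr>carrier := N\<rparr>"
  shows "N \<subseteq> normalizer G C"
proof
  fix h assume h: "h \<in> N"
  interpret C: normal C "G\<lparr>carrier := N\<rparr>" by fact
  have C: "C \<subseteq> carrier G" using C.subset subgroup.subset[OF assms(1)] by auto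
  have hG: "h \<in> carrier G" using h subgroup.subset[OF assms(1)] by blast
  have "h <# C = C #> h" using C.coset_eq h by (simp add: l_coset_def r_coset_def)
  then have "h <# C #> inv h = C #> (h \<otimes> inv h)" using C hG by (simp add: coset_mult_assoc)
  then show "h \<in> normalizer G C" using C hG by (simp add: mem_normalizer_iff)
qed

lemma (in group) normalizer_conjugates:
  assumes "C \<subseteq> carrier G" "h \<in> normalizer G C" "c \<in> C"
  shows "h \<otimes> c \<otimes> inv h \<in> C" "inv h \<otimes> c \<otimes> h \<in> C"
proof -
  have h: "h \<in> carrier G" "h <# C #> inv h = C" using assms mem_normalizer_iff by auto
  have eq: "h <# C #> inv h = {h \<otimes> d \<otimes> inv h | d. d \<in> C}"
    by (auto simp: l_coset_def r_coset_def)
  then show "h \<otimes> c \<otimes> inv h \<in> C" using assms(3) h(2) by auto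
  have "c \<in> {h \<otimes> d \<otimes> inv h | d. d \<in> C}" using assms(3) h(2) eq by simp
  then obtain d where d: "d \<in> C" "c = h \<otimes> d \<otimes> inv h" by blast
  have "d \<in> carrier G" using d assms(1) by blast
  then have "inv h \<otimes> c \<otimes> h = d" using h(1) d(2)
    by (simp add: m_assoc inv_solve_left')
  then show "inv h \<otimes> c \<otimes> h \<in> C" using d(1) by simp
qed

section \<open>Piecewise linear homeomorphisms of the line\<close>

text \<open>Being affine near a point replaces slopes and breaks throughout: it is stable under
  composition and inversion, and refers to no derivative.\<close>

definition affine_at :: "(real \<Rightarrow> real) \<Rightarrow> real \<Rightarrow> real \<Rightarrow> bool" where
  "affine_at f x m \<longleftrightarrow> (\<exists>c. \<forall>\<^sub>F y in nhds x. f y = m * y + c)"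

lemma affine_at_iff:
  "affine_at f x m \<longleftrightarrow> (\<exists>e>0. \<forall>y. \<bar>y - x\<bar> < e \<longrightarrow> f y = f x + m * (y - x))"
proof
  assume "affine_at f x m"
  then obtain c e where "e > 0" and *: "\<And>y. \<bar>y - x\<bar> < e \<Longrightarrow> f y = m * y + c"
    unfolding affine_at_def eventually_nhds_metric by (auto simp: dist_real_def)
  then have "f x = m * x + c" by simp
  then show "\<exists>e>0. \<forall>y. \<bar>y - x\<bar> < e \<longrightarrow> f y = f x + m * (y - x)"
    using \<open>e > 0\<close> * by (intro exI[of _ e]) (auto simp: algebra_simps)
next
  assume "\<exists>e>0. \<forall>y. \<bar>y - x\<bar> < e \<longrightarrow> f y = f x + m * (y - x)"
  then obtain e where "e > 0" and *: "\<And>y. \<bar>y - x\<bar> < e \<Longrightarrow> f y = f x + m * (y - x)" by auto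
  then have "\<forall>\<^sub>F y in nhds x. f y = m * y + (f x - m * x)"
    unfolding eventually_nhds_metric
    by (intro exI[of _ e]) (auto simp: dist_real_def algebra_simps)
  then show "affine_at f x m" unfolding affine_at_def by blast
qed

lemma affine_at_open_interval:
  assumes "x \<in> {a<..<b}" "\<And>y. y \<in> {a<..<b} \<Longrightarrow> f y = m * y + c"
  shows "affine_at f x m"
  unfolding affine_at_def
  using assms eventually_nhds_in_open[of "{a<..<b}" x]
  by (intro exI[of _ c]) (auto elim!: eventually_mono)

lemma affine_at_has_derivative:
  assumes "affine_at f x m" shows "(f has_real_derivative m) (at x)"
proof -
  obtain c where c: "\<forall>\<^sub>F y in nhds x. f y = m * y + c" using assms by (auto simp: affine_at_def)
  have "((\<lambda>y. m * y + c) has_real_derivative m) (at x)"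
    by (auto intro!: derivative_eq_intros)
  then show ?thesis using c by (subst DERIV_cong_ev[OF refl _ refl])
qed

lemma affine_at_unique: "affine_at f x m \<Longrightarrow> affine_at f x m' \<Longrightarrow> m = m'"
  using affine_at_has_derivative DERIV_unique by blast

lemma affine_at_filterlim: "affine_at f x m \<Longrightarrow> filterlim f (nhds (f x)) (nhds x)"
  using affine_at_has_derivative DERIV_isCont unfolding isCont_def tendsto_at_iff_tendsto_nhds
  by blast

lemma affine_at_eventually:
  assumes "affine_at f x m" shows "\<forall>\<^sub>F y in nhds x. affine_at f y m"
proof -
  obtain c where "\<forall>\<^sub>F y in nhds x. f y = m * y + c" using assms by (auto simp: affine_at_def)
  then have "\<forall>\<^sub>F y in nhds x. \<forall>\<^sub>F z in nhds y. f z = m * z + c"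
    by (simp add: eventually_eventually)
  then show ?thesis by (rule eventually_mono) (auto simp: affine_at_def)
qed

lemma affine_at_comp:
  assumes "affine_at f x a" "affine_at g (f x) b"
  shows "affine_at (g \<circ> f) x (b * a)"
proof -
  obtain c where c: "\<forall>\<^sub>F y in nhds x. f y = a * y + c" using assms(1) by (auto simp: affine_at_def)
  obtain d where "\<forall>\<^sub>F y in nhds (f x). g y = b * y + d"
    using assms(2) by (auto simp: affine_at_def)
  then have "\<forall>\<^sub>F y in nhds x. g (f y) = b * f y + d"
    using eventually_compose_filterlim affine_at_filterlim[OF assms(1)] by blast
  with c have "\<forall>\<^sub>F y in nhds x. (g \<circ> f) y = b * a * y + (b * c + d)"
    by eventually_elim (simp add: algebra_simps)
  then show ?thesis unfolding affine_at_def by blast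
qed

lemma affine_at_inverse:
  assumes "affine_at f x m" "m \<noteq> 0" "isCont g (f x)" "\<And>y. f (g y) = y" "\<And>y. g (f y) = y"
  shows "affine_at g (f x) (1 / m)"
proof -
  obtain c where "\<forall>\<^sub>F y in nhds x. f y = m * y + c" using assms(1) by (auto simp: affine_at_def)
  moreover have "filterlim g (nhds x) (nhds (f x))"
    using assms(3,5) unfolding isCont_def tendsto_at_iff_tendsto_nhds by simp
  ultimately have "\<forall>\<^sub>F y in nhds (f x). f (g y) = m * g y + c"
    using eventually_compose_filterlim by blast
  then have "\<forall>\<^sub>F y in nhds (f x). g y = 1 / m * y + (- c / m)"
    by eventually_elim (use assms in \<open>simp add: field_simps\<close>)
  then show ?thesis unfolding affine_at_def by blast
qed

text \<open>Local finiteness leaves no exceptional points in a punctured neighbourhood of \<open>x\<close>; the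
  affine pieces on both sides extend to \<open>x\<close> by continuity.\<close>

lemma PL_one_sided_affine:
  assumes "PL f"
  obtains e l r where "e > 0"
    "\<And>y. y \<in> {x - e<..x} \<Longrightarrow> f y = f x + l * (y - x)"
    "\<And>y. y \<in> {x..<x + e} \<Longrightarrow> f y = f x + r * (y - x)"
proof -
  have cont: "isCont f x" using assms by (simp add: PL_def continuous_on_eq_continuous_at)
  obtain B where fin: "\<And>a b. finite (B \<inter> {a..b})"
    and aff: "\<And>a b. {a<..<b} \<inter> B = {} \<Longrightarrow> \<exists>m c. \<forall>x\<in>{a<..<b}. f x = m * x + c"
    using assms unfolding PL_def by blast
  obtain d where d: "d > 0" "\<And>y. y \<in> B \<inter> {x - 1..x + 1} \<Longrightarrow> y \<noteq> x \<Longrightarrow> d \<le> dist x y"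
    using finite_set_avoid[OF fin] by metis
  define e where "e = min d 1"
  have e: "e > 0" "e \<le> 1" "e \<le> d" using d unfolding e_def by auto
  have "{x - e<..<x} \<inter> B = {}" "{x<..<x + e} \<inter> B = {}"
    using d(2) e by (force simp: dist_real_def)+
  then obtain l c r k where l: "\<And>y. y \<in> {x - e<..<x} \<Longrightarrow> f y = l * y + c"
    and r: "\<And>y. y \<in> {x<..<x + e} \<Longrightarrow> f y = r * y + k" using aff by metis
  have "\<forall>\<^sub>F y in at_left x. f y = l * y + c"
    using l e(1) unfolding eventually_at_left_field by (intro exI[of _ "x - e"]) auto
  moreover have "((\<lambda>y. l * y + c) \<longlongrightarrow> l * x + c) (at_left x)"
    by (intro tendsto_intros)
  ultimately have "(f \<longlongrightarrow> l * x + c) (at_left x)"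
    using tendsto_cong by fastforce
  moreover have "(f \<longlongrightarrow> f x) (at_left x)"
    using cont unfolding isCont_def by (rule tendsto_within_subset) auto
  ultimately have fl: "f x = l * x + c"
    using tendsto_unique[OF trivial_limit_at_left_real] by blast
  have "\<forall>\<^sub>F y in at_right x. f y = r * y + k"
    using r e(1) unfolding eventually_at_right_field by (intro exI[of _ "x + e"]) auto
  moreover have "((\<lambda>y. r * y + k) \<longlongrightarrow> r * x + k) (at_right x)"
    by (intro tendsto_intros)
  ultimately have "(f \<longlongrightarrow> r * x + k) (at_right x)"
    using tendsto_cong by fastforce
  moreover have "(f \<longlongrightarrow> f x) (at_right x)"
    using cont unfolding isCont_def by (rule tendsto_within_subset) auto
  ultimately have fr: "f x = r * x + k"
    using tendsto_unique[OF trivial_limit_at_right_real] by blast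
  show thesis
  proof (rule that[OF e(1)])
    fix y assume "y \<in> {x - e<..x}"
    then show "f y = f x + l * (y - x)"
      using l[of y] fl by (cases "y = x") (auto simp: algebra_simps)
  next
    fix y assume "y \<in> {x..<x + e}"
    then show "f y = f x + r * (y - x)"
      using r[of y] fr by (cases "y = x") (auto simp: algebra_simps)
  qed
qed

lemma PL_affine [simp]: "PL (\<lambda>x. m * x + c)"
  unfolding PL_def by (auto intro!: continuous_intros exI[of _ "{}"])

lemma PL_compose:
  assumes "PL f" "PL g" "strict_mono f" shows "PL (g \<circ> f)"
proof -
  obtain A where A: "\<And>a b. finite (A \<inter> {a..b})"
    "\<And>a b. {a<..<b} \<inter> A = {} \<Longrightarrow> \<exists>m c. \<forall>x\<in>{a<..<b}. f x = m * x + c"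
    using assms(1) unfolding PL_def by blast
  obtain B where B: "\<And>a b. finite (B \<inter> {a..b})"
    "\<And>a b. {a<..<b} \<inter> B = {} \<Longrightarrow> \<exists>m c. \<forall>x\<in>{a<..<b}. g x = m * x + c"
    using assms(2) unfolding PL_def by blast
  note less = strict_mono_less[OF assms(3)] and le = strict_mono_less_eq[OF assms(3)]
  have "continuous_on UNIV (g \<circ> f)"
    using assms(1,2) unfolding PL_def by (metis continuous_on_compose continuous_on_subset top_greatest)
  moreover have "finite ((A \<union> f -` B) \<inter> {a..b})" for a b
  proof -
    have "finite (f -` (B \<inter> {f a..f b}))"
      using B(1) assms(3) by (intro finite_vimageI) (auto simp: strict_mono_imp_inj_on)
    moreover have "(A \<union> f -` B) \<inter> {a..b} \<subseteq> (A \<inter> {a..b}) \<union> f -` (B \<inter> {f a..f b})"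
      by (auto simp: le)
    ultimately show ?thesis using A(1) finite_subset by blast
  qed
  moreover have "\<exists>m c. \<forall>x\<in>{a<..<b}. (g \<circ> f) x = m * x + c"
    if "{a<..<b} \<inter> (A \<union> f -` B) = {}" for a b
  proof -
    have "{a<..<b} \<inter> A = {}" using that by blast
    then obtain m c where mc: "\<And>x. x \<in> {a<..<b} \<Longrightarrow> f x = m * x + c" using A(2) by meson
    have "{f a<..<f b} \<inter> B = {}"
    proof (rule ccontr)
      assume "{f a<..<f b} \<inter> B \<noteq> {}"
      then obtain y where y: "f a < y" "y < f b" "y \<in> B" by auto
      then have "a \<le> b" by (meson le less_trans linorder_le_cases not_less order_less_imp_le)
      then obtain x where "f x = y"
        using y IVT'[of f a y b] assms(1) unfolding PL_def
        by (meson continuous_on_subset less_imp_le top_greatest)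
      then show False using y that less by auto
    qed
    then obtain k d where kd: "\<And>x. x \<in> {f a<..<f b} \<Longrightarrow> g x = k * x + d" using B(2) by meson
    have "(g \<circ> f) x = (k * m) * x + (k * c + d)" if "x \<in> {a<..<b}" for x
    proof -
      have "f x \<in> {f a<..<f b}" using that by (simp add: less)
      then show ?thesis using mc[OF that] kd by (simp add: algebra_simps)
    qed
    then show ?thesis by blast
  qed
  ultimately show ?thesis unfolding PL_def by blast
qed

lemma PL_inverse:
  assumes "PL f" "strict_mono f" "continuous_on UNIV g" "\<And>y. f (g y) = y" "\<And>y. g (f y) = y"
  shows "PL g"
proof -
  obtain B where B: "\<And>a b. finite (B \<inter> {a..b})"
    "\<And>a b. {a<..<b} \<inter> B = {} \<Longrightarrow> \<exists>m c. \<forall>x\<in>{a<..<b}. f x = m * x + c"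
    using assms(1) unfolding PL_def by blast
  have less: "g x < g y \<longleftrightarrow> x < y" and le: "g x \<le> g y \<longleftrightarrow> x \<le> y" for x y
    using strict_mono_less[OF assms(2), of "g x" "g y"] strict_mono_less_eq[OF assms(2), of "g x" "g y"]
    by (simp_all add: assms(4))
  have "finite (f ` B \<inter> {a..b})" for a b
  proof -
    have "x \<in> {g a..g b}" if "f x \<in> {a..b}" for x
      using that le[of a "f x"] le[of "f x" b] by (simp add: assms(5))
    then have "f ` B \<inter> {a..b} \<subseteq> f ` (B \<inter> {g a..g b})" by blast
    then show ?thesis using B(1) finite_subset by blast
  qed
  moreover have "\<exists>m c. \<forall>x\<in>{a<..<b}. g x = m * x + c"
    if ab: "{a<..<b} \<inter> f ` B = {}" for a b
  proof (cases "a < b")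
    case True
    have "f x \<in> {a<..<b}" if "x \<in> {g a<..<g b}" for x
      using that less[of a "f x"] less[of "f x" b] by (simp add: assms(5))
    then have "{g a<..<g b} \<inter> B = {}" using ab by blast
    then obtain m c where mc: "\<And>x. x \<in> {g a<..<g b} \<Longrightarrow> f x = m * x + c" using B(2) by meson
    have y: "y = m * g y + c" if "y \<in> {a<..<b}" for y
      using mc[of "g y"] that by (simp add: less assms(4))
    have "m \<noteq> 0"
    proof
      assume "m = 0"
      then have "y = c" if "y \<in> {a<..<b}" for y using y[OF that] by simp
      moreover obtain u v where "a < u" "u < v" "v < b" using True dense by meson
      ultimately have "u = c" "v = c" by auto
      then show False using \<open>u < v\<close> by simp
    qed
    then have "g y = 1 / m * y + (- c / m)" if "y \<in> {a<..<b}" for y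
      using y[OF that] by (simp add: field_simps)
    then show ?thesis by blast
  qed auto
  ultimately show ?thesis using assms(3) unfolding PL_def by blast
qed

lemma affine_at_not_break: assumes "affine_at f x m" shows "x \<notin> breaks f"
proof -
  have ev: "\<forall>\<^sub>F y in nhds x. (f has_real_derivative m) (at y)"
    using affine_at_eventually[OF assms] by (rule eventually_mono) (rule affine_at_has_derivative)
  then have "\<forall>\<^sub>F y in nhds x. f differentiable (at y)"
    by (rule eventually_mono) (auto simp: real_differentiable_def)
  moreover have "\<forall>\<^sub>F y in nhds x. deriv f y = m"
    using ev by (rule eventually_mono) (rule DERIV_imp_deriv)
  then have "isCont (deriv f) x" by (subst isCont_cong[where g = "\<lambda>_. m"]) auto
  ultimately show ?thesis by (simp add: breaks_def)
qed

text \<open>Continuity of the derivative at \<open>x\<close> forces the two one-sided slopes to agree.\<close>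

lemma affine_at_if_not_break:
  assumes "PL f" "x \<notin> breaks f" obtains m where "affine_at f x m"
proof -
  obtain e l r where e: "e > 0"
    and l: "\<And>y. y \<in> {x - e<..x} \<Longrightarrow> f y = f x + l * (y - x)"
    and r: "\<And>y. y \<in> {x..<x + e} \<Longrightarrow> f y = f x + r * (y - x)"
    using PL_one_sided_affine[OF assms(1)] by blast
  have "isCont (deriv f) x" using assms(2) by (simp add: breaks_def)
  then have cont: "(deriv f \<longlongrightarrow> deriv f x) (at_left x)" "(deriv f \<longlongrightarrow> deriv f x) (at_right x)"
    unfolding isCont_def by (auto intro: tendsto_within_subset)
  have "deriv f y = l" if "y \<in> {x - e<..<x}" for y
  proof -
    have "affine_at f y l"
      by (rule affine_at_open_interval[OF that, of _ _ "f x - l * x"])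
         (use l in \<open>auto simp: algebra_simps\<close>)
    then show ?thesis by (intro DERIV_imp_deriv affine_at_has_derivative)
  qed
  then have "\<forall>\<^sub>F y in at_left x. deriv f y = l"
    using e unfolding eventually_at_left_field by (intro exI[of _ "x - e"]) auto
  then have "(deriv f \<longlongrightarrow> l) (at_left x)" by (rule tendsto_eventually)
  then have "deriv f x = l" using cont tendsto_unique[OF trivial_limit_at_left_real] by blast
  moreover have "deriv f y = r" if "y \<in> {x<..<x + e}" for y
  proof -
    have "affine_at f y r"
      by (rule affine_at_open_interval[OF that, of _ _ "f x - r * x"])
         (use r in \<open>auto simp: algebra_simps\<close>)
    then show ?thesis by (intro DERIV_imp_deriv affine_at_has_derivative)
  qed
  then have "\<forall>\<^sub>F y in at_right x. deriv f y = r"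
    using e unfolding eventually_at_right_field by (intro exI[of _ "x + e"]) auto
  then have "(deriv f \<longlongrightarrow> r) (at_right x)" by (rule tendsto_eventually)
  then have "deriv f x = r" using cont tendsto_unique[OF trivial_limit_at_right_real] by blast
  ultimately have "l = r" by simp
  have "f y = f x + r * (y - x)" if "\<bar>y - x\<bar> < e" for y
  proof (cases "y \<le> x")
    case True
    then show ?thesis using that \<open>l = r\<close> by (subst l) auto
  next
    case False
    then show ?thesis using that by (intro r) auto
  qed
  then have "affine_at f x r" unfolding affine_at_iff using e by blast
  then show thesis by (rule that)
qed

lemma discrete_breaks: "PL f \<Longrightarrow> discrete (breaks f)"
  unfolding discrete_def
proof
  fix x assume "PL f" "x \<in> breaks f"
  obtain e l r where e: "e > 0"
    and l: "\<And>y. y \<in> {x - e<..x} \<Longrightarrow> f y = f x + l * (y - x)"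
    and r: "\<And>y. y \<in> {x..<x + e} \<Longrightarrow> f y = f x + r * (y - x)"
    using PL_one_sided_affine[OF \<open>PL f\<close>] by blast
  have "y \<notin> breaks f" if "y \<in> {x - e<..<x + e}" "y \<noteq> x" for y
  proof (cases "y < x")
    case True
    then have "affine_at f y l"
      using that by (intro affine_at_open_interval[of _ "x - e" x _ _ "f x - l * x"])
         (use l in \<open>auto simp: algebra_simps\<close>)
    then show ?thesis by (rule affine_at_not_break)
  next
    case False
    then have "affine_at f y r"
      using that by (intro affine_at_open_interval[of _ x "x + e" _ _ "f x - r * x"])
         (use r in \<open>auto simp: algebra_simps\<close>)
    then show ?thesis by (rule affine_at_not_break)
  qed
  then have "{x - e<..<x + e} \<inter> breaks f \<subseteq> {x}" by blast
  then have "{x - e<..<x + e} \<inter> breaks f = {x}" using \<open>x \<in> breaks f\<close> e by auto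
  then show "x isolated_in breaks f"
    using \<open>x \<in> breaks f\<close> unfolding isolated_in_def by (metis open_greaterThanLessThan)
qed

lemma mem_HomeoR:
  "f \<in> carrier HomeoR \<longleftrightarrow> bij f \<and> continuous_on UNIV f \<and> continuous_on UNIV (inv_into UNIV f)"
proof
  assume "f \<in> carrier HomeoR"
  then obtain g where g: "homeomorphism UNIV UNIV f g" by (auto simp: HomeoR_def)
  then have "inv_into UNIV f = g" by (intro inv_equality) (auto simp: homeomorphism_def)
  moreover have "bij f" using g unfolding homeomorphism_def by (intro o_bij[of g]) auto
  ultimately show "bij f \<and> continuous_on UNIV f \<and> continuous_on UNIV (inv_into UNIV f)"
    using g by (auto simp: homeomorphism_def)
next
  assume "bij f \<and> continuous_on UNIV f \<and> continuous_on UNIV (inv_into UNIV f)"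
  then have "homeomorphism UNIV UNIV f (inv_into UNIV f)"
    unfolding homeomorphism_def
    by (auto simp: bij_is_surj bij_imp_bij_inv surj_f_inv_f bij_is_inj)
  then show "f \<in> carrier HomeoR" by (auto simp: HomeoR_def)
qed

lemma HomeoR_ops [simp]: "f \<otimes>\<^bsub>HomeoR\<^esub> g = g \<circ> f" "\<one>\<^bsub>HomeoR\<^esub> = id"
  by (simp_all add: HomeoR_def)

lemma HomeoR_inv_closed: "f \<in> carrier HomeoR \<Longrightarrow> inv_into UNIV f \<in> carrier HomeoR"
  by (simp add: mem_HomeoR bij_imp_bij_inv inv_inv_eq)

lemma HomeoR_comp_closed: "f \<in> carrier HomeoR \<Longrightarrow> g \<in> carrier HomeoR \<Longrightarrow> g \<circ> f \<in> carrier HomeoR"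
  unfolding HomeoR_def using homeomorphism_compose[of UNIV UNIV f _ UNIV g] by auto

lemma group_HomeoR: "group HomeoR"
proof (rule groupI)
  show "\<exists>g\<in>carrier HomeoR. g \<otimes>\<^bsub>HomeoR\<^esub> f = \<one>\<^bsub>HomeoR\<^esub>" if "f \<in> carrier HomeoR" for f
    using that HomeoR_inv_closed[OF that]
    by (intro bexI[of _ "inv_into UNIV f"]) (auto simp: mem_HomeoR bij_is_surj surj_iff[symmetric])
next
  show "\<one>\<^bsub>HomeoR\<^esub> \<in> carrier HomeoR" by (auto simp: mem_HomeoR continuous_on_id')
qed (auto simp: HomeoR_comp_closed o_assoc)

lemma HomeoR_m_inv: "f \<in> carrier HomeoR \<Longrightarrow> inv\<^bsub>HomeoR\<^esub> f = inv_into UNIV f"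
  using HomeoR_inv_closed[of f]
  by (intro group.inv_equality[OF group_HomeoR]) (auto simp: mem_HomeoR bij_is_surj surj_iff[symmetric])

lemma HomeoR_f_inv [simp]: "f \<in> carrier HomeoR \<Longrightarrow> f (inv_into UNIV f y) = y"
  and HomeoR_inv_f [simp]: "f \<in> carrier HomeoR \<Longrightarrow> inv_into UNIV f (f x) = x"
  by (simp_all add: mem_HomeoR bij_is_surj bij_is_inj surj_f_inv_f)

lemma HomeoR_I:
  assumes "continuous_on UNIV f" "continuous_on UNIV g" "\<And>x. g (f x) = x" "\<And>y. f (g y) = y"
  shows "f \<in> carrier HomeoR"
proof -
  have "homeomorphism UNIV UNIV f g"
    using assms unfolding homeomorphism_def by (metis UNIV_eq_I rangeI)
  then show ?thesis unfolding HomeoR_def by auto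
qed

lemma strict_mono_inv_HomeoR:
  assumes "f \<in> carrier HomeoR" "strict_mono f" shows "strict_mono (inv_into UNIV f)"
proof (rule strict_monoI)
  fix x y :: real assume "x < y"
  then show "inv_into UNIV f x < inv_into UNIV f y"
    using strict_mono_less[OF assms(2), of "inv_into UNIV f x" "inv_into UNIV f y"] assms(1) by simp
qed

lemma PL_inv_HomeoR:
  assumes "f \<in> carrier HomeoR" "strict_mono f" "PL f" shows "PL (inv_into UNIV f)"
  using PL_inverse[OF assms(3,2), of "inv_into UNIV f"] assms(1) by (simp add: mem_HomeoR)

text \<open>The identity on the left of \<open>x\<close>, slope \<open>m\<close> on the right; in this form continuity is evident.\<close>

definition hinge :: "real \<Rightarrow> real \<Rightarrow> real \<Rightarrow> real" where
  "hinge m x t = x + min (t - x) 0 + m * max (t - x) 0"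

lemma hinge_simps: "t \<le> x \<Longrightarrow> hinge m x t = t" "x \<le> t \<Longrightarrow> hinge m x t = x + m * (t - x)"
  by (auto simp: hinge_def)

lemma hinge_inverse: "m > 0 \<Longrightarrow> hinge (inverse m) x (hinge m x t) = t"
  by (cases "t \<le> x") (simp_all add: hinge_simps mult.assoc[symmetric])

lemma continuous_hinge: "continuous_on UNIV (hinge m x)"
  unfolding hinge_def by (intro continuous_intros)

lemma strict_mono_hinge: assumes "m > 0" shows "strict_mono (hinge m x)"
proof (rule strict_monoI)
  fix s t :: real assume "s < t"
  show "hinge m x s < hinge m x t"
  proof (cases "t \<le> x")
    case True
    then show ?thesis using \<open>s < t\<close> by (simp add: hinge_simps)
  next
    case False
    then have "m * (t - x) > 0" using assms by simp
    then have "x < hinge m x t" using False by (simp add: hinge_simps)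
    moreover have "m * s < m * t" using assms \<open>s < t\<close> by simp
    ultimately show ?thesis
      using False by (cases "s \<le> x") (simp_all add: hinge_simps right_diff_distrib)
  qed
qed

lemma PL_hinge: "PL (hinge m x)"
  unfolding PL_def
proof (intro conjI exI[of _ "{x}"] allI impI)
  fix a b assume "{a<..<b} \<inter> {x} = {}"
  then have "b \<le> x \<or> x \<le> a" by auto
  then show "\<exists>k c. \<forall>t\<in>{a<..<b}. hinge m x t = k * t + c"
  proof
    assume "b \<le> x"
    then have "\<forall>t\<in>{a<..<b}. hinge m x t = 1 * t + 0" by (simp add: hinge_simps)
    then show ?thesis by blast
  next
    assume "x \<le> a"
    then have "\<forall>t\<in>{a<..<b}. hinge m x t = m * t + (x - m * x)"
      by (simp add: hinge_simps algebra_simps)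
    then show ?thesis by blast
  qed
qed (auto simp: continuous_hinge)

section \<open>The ring and its units\<close>

lemma monoid_rat_units [simp]:
  "carrier rat_units = \<rat> - {0}" "x \<otimes>\<^bsub>rat_units\<^esub> y = x * y" "\<one>\<^bsub>rat_units\<^esub> = 1"
  by (simp_all add: rat_units_def)

lemma group_rat_units: "group rat_units"
proof (rule groupI)
  fix x assume "x \<in> carrier rat_units"
  then show "\<exists>y\<in>carrier rat_units. y \<otimes>\<^bsub>rat_units\<^esub> x = \<one>\<^bsub>rat_units\<^esub>"
    by (intro bexI[of _ "inverse x"]) auto
qed auto

lemma inv_rat_units: "x \<in> \<rat> - {0} \<Longrightarrow> inv\<^bsub>rat_units\<^esub> x = inverse x"
  using group.inv_equality[OF group_rat_units, of "inverse x" x]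
  by simp

lemma Z_inv_iff:
  assumes "n > 0"
  shows "x \<in> Z_inv n \<longleftrightarrow> (\<exists>a (k::nat). x = of_int a / real n ^ k)"
proof
  assume "x \<in> Z_inv n"
  then obtain a b where x: "x = of_int a * real n powi b" by (auto simp: Z_inv_def)
  show "\<exists>a (k::nat). x = of_int a / real n ^ k"
  proof (cases "b \<ge> 0")
    case True
    then have "x = of_int (a * int n ^ nat b) / real n ^ 0" by (simp add: x power_int_def)
    then show ?thesis by blast
  next
    case False
    then have "x = of_int a / real n ^ nat (-b)" by (simp add: x power_int_def field_simps)
    then show ?thesis by blast
  qed
next
  assume "\<exists>a (k::nat). x = of_int a / real n ^ k"
  then obtain a k where "x = of_int a / real n ^ k" by blast
  then have "x = of_int a * real n powi (- int k)" by (simp add: power_int_minus field_simps)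
  then show "x \<in> Z_inv n" unfolding Z_inv_def by blast
qed

lemma Z_inv_int [simp]: "of_int a \<in> Z_inv n"
proof -
  have "of_int a = of_int a * real n powi 0" by simp
  then show ?thesis unfolding Z_inv_def by blast
qed

lemma Z_inv_0 [simp]: "0 \<in> Z_inv n" and Z_inv_1 [simp]: "1 \<in> Z_inv n"
  and Z_inv_nat [simp]: "real k \<in> Z_inv n"
  using Z_inv_int[of 0] Z_inv_int[of 1] Z_inv_int[of "int k"] by simp_all

lemma Z_inv_powi: "real n powi k \<in> Z_inv n"
proof -
  have "real n powi k = of_int 1 * real n powi k" by simp
  then show ?thesis unfolding Z_inv_def by blast
qed

text \<open>Points outside the ring are dense because the ring is countable; hence the behaviour of a
  PL map near these points determines all of its slopes.\<close>

lemma Z_inv_codense: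
  assumes "a < b" obtains z where "z \<notin> Z_inv n" "a < z" "z < b"
proof -
  have "Z_inv n = range (\<lambda>(a, b). of_int a * real n powi b)" by (auto simp: Z_inv_def)
  then have "countable (Z_inv n)" by simp
  then have "\<not> {a<..<b} \<subseteq> Z_inv n"
    using uncountable_open_interval[of a b] assms countable_subset by blast
  then obtain z where "z \<in> {a<..<b}" "z \<notin> Z_inv n" by blast
  then show thesis using that by simp
qed

lemma powers_1 [simp]: "1 \<in> powers_group n"
  unfolding powers_group_def by (auto intro: exI[of _ 0])

lemma powers_n [simp]: "real n \<in> powers_group n"
  unfolding powers_group_def by (auto intro: exI[of _ 1])

lemma powers_inverse: "p \<in> powers_group n \<Longrightarrow> inverse p \<in> powers_group n"
  unfolding powers_group_def by (auto simp flip: power_int_minus)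

lemma powers_subset_Z_inv: "p \<in> powers_group n \<Longrightarrow> p \<in> Z_inv n"
  by (auto simp: powers_group_def Z_inv_powi)

lemma semidirect_simps:
  "carrier (semidirect_product N Q act) = carrier N \<times> carrier Q"
  "(a, s) \<otimes>\<^bsub>semidirect_product N Q act\<^esub> (b, t) = (a \<otimes>\<^bsub>N\<^esub> act s b, s \<otimes>\<^bsub>Q\<^esub> t)"
  "\<one>\<^bsub>semidirect_product N Q act\<^esub> = (\<one>\<^bsub>N\<^esub>, \<one>\<^bsub>Q\<^esub>)"
  by (simp_all add: semidirect_product_def)

context
  fixes n :: nat
  assumes n2: "n \<ge> 2"
begin

lemma Z_inv_mult: assumes "x \<in> Z_inv n" "y \<in> Z_inv n" shows "x * y \<in> Z_inv n"
proof -
  obtain a b c d where "x = of_int a * real n powi b" "y = of_int c * real n powi d"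
    using assms by (auto simp: Z_inv_def)
  then have "x * y = of_int (a * c) * real n powi (b + d)"
    using n2 by (simp add: power_int_add)
  then show ?thesis unfolding Z_inv_def by blast
qed

lemma Z_inv_uminus: "x \<in> Z_inv n \<Longrightarrow> - x \<in> Z_inv n"
  using Z_inv_mult[of "-1" x] Z_inv_int[of "-1"] by simp

text \<open>A common denominator gives both the additive closure of the ring and the additivity of
  \<^const>\<open>phi\<close>.\<close>

lemma Z_inv_common_denominator:
  assumes "x \<in> Z_inv n" "y \<in> Z_inv n"
  obtains a b e where "x = of_int a * real n powi e" "y = of_int b * real n powi e"
proof -
  obtain a k c l where x: "x = of_int a / real n ^ k" and y: "y = of_int c / real n ^ l"
    using assms n2 by (auto simp: Z_inv_iff)
  have "x = of_int (a * int n ^ l) * real n powi (- int (k + l))"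
    and "y = of_int (c * int n ^ k) * real n powi (- int (k + l))"
    using n2 by (simp_all only: x y power_int_minus power_int_of_nat)
      (simp_all add: power_add divide_inverse)
  then show thesis by (rule that)
qed

lemma Z_inv_add: assumes "x \<in> Z_inv n" "y \<in> Z_inv n" shows "x + y \<in> Z_inv n"
proof -
  obtain a b e where "x = of_int a * real n powi e" "y = of_int b * real n powi e"
    using Z_inv_common_denominator[OF assms] by blast
  then have "x + y = of_int (a + b) * real n powi e" by (simp add: algebra_simps)
  then show ?thesis unfolding Z_inv_def by blast
qed

lemma Z_inv_diff: "x \<in> Z_inv n \<Longrightarrow> y \<in> Z_inv n \<Longrightarrow> x - y \<in> Z_inv n"
  using Z_inv_add[of x "-y"] Z_inv_uminus[of y] by simp

lemma Z_inv_dense: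
  assumes "a < b" obtains z where "z \<in> Z_inv n" "a < z" "z < b"
proof -
  obtain k where k: "1 / (b - a) < real n ^ k"
    using real_arch_pow[of "real n" "1 / (b - a)"] n2 by auto
  define m where "m = \<lfloor>a * real n ^ k\<rfloor> + 1"
  have np: "real n ^ k > 0" using n2 by simp
  have "1 < (b - a) * real n ^ k" using k assms by (simp add: field_simps)
  moreover have "a * real n ^ k < m" "m \<le> a * real n ^ k + 1" unfolding m_def by linarith+
  ultimately have "a < m / real n ^ k" "m / real n ^ k < b"
    using np by (simp_all add: field_simps)
  moreover have "of_int m / real n ^ k \<in> Z_inv n" using n2 by (auto simp: Z_inv_iff)
  ultimately show thesis using that by blast
qed

text \<open>By density, a translation in the kernel of \<open>\<rho>\<^sub>n\<close> can move any point into any interval.\<close>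

lemma Z_inv_multiples_dense:
  assumes "a < b" obtains z where "z \<in> Z_inv n" "a < real (n - 1) * z" "real (n - 1) * z < b"
proof -
  have p: "real (n - 1) > 0" using n2 by simp
  then have "a / real (n - 1) < b / real (n - 1)" using assms by (simp add: divide_strict_right_mono)
  then obtain z where "z \<in> Z_inv n" "a / real (n - 1) < z" "z < b / real (n - 1)"
    using Z_inv_dense by blast
  then show thesis using that[of z] p by (simp add: field_simps)
qed

lemma n_power_cong_1: "[int n ^ k = 1] (mod int (n - 1))"
proof -
  have "[int n = 1] (mod int (n - 1))" using n2 by (simp add: cong_iff_dvd_diff)
  then show ?thesis using cong_pow[of "int n" 1 _ k] by simp
qed

text \<open>Both representations \<open>a n\<^sup>b = c n\<^sup>d\<close> become integers after multiplication by a
  power of \<open>n\<close>, and \<open>n\<close> is \<open>1\<close> modulo \<open>n - 1\<close>.\<close>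

lemma phi_eq: "phi n (of_int a * real n powi b) = a mod int (n - 1)"
  unfolding phi_def
proof (rule the_equality)
  fix r assume "\<exists>c d. of_int a * real n powi b = of_int c * real n powi d \<and> r = c mod int (n - 1)"
  then obtain c d where eq: "of_int a * real n powi b = of_int c * real n powi d"
    and r: "r = c mod int (n - 1)" by blast
  define e where "e = \<bar>b\<bar> + \<bar>d\<bar>"
  have "of_int a * real n powi (b + e) = of_int c * real n powi (d + e)"
    using eq n2 by (simp add: power_int_add)
  moreover have "b + e \<ge> 0" "d + e \<ge> 0" unfolding e_def by auto
  ultimately have "real_of_int (a * int n ^ nat (b + e)) = of_int (c * int n ^ nat (d + e))"
    by (simp add: power_int_def)
  then have "a * int n ^ nat (b + e) = c * int n ^ nat (d + e)" by linarith
  moreover have "[a * int n ^ nat (b + e) = a * 1] (mod int (n - 1))"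
    "[c * int n ^ nat (d + e) = c * 1] (mod int (n - 1))"
    by (intro cong_mult n_power_cong_1 cong_refl)+
  ultimately have "[a = c] (mod int (n - 1))" by (metis cong_sym cong_trans mult.right_neutral)
  then show "r = a mod int (n - 1)" using r by (simp add: cong_def)
qed blast

lemma phi_int [simp]: "phi n (of_int a) = a mod int (n - 1)"
  using phi_eq[of a 0] by simp

lemma phi_0 [simp]: "phi n 0 = 0"
  using phi_int[of 0] by simp

lemma phi_range: "x \<in> Z_inv n \<Longrightarrow> 0 \<le> phi n x \<and> phi n x < int (n - 1)"
  using n2 by (auto simp: Z_inv_def phi_eq)

lemma phi_mod [simp]: "x \<in> Z_inv n \<Longrightarrow> phi n x mod int (n - 1) = phi n x"
  using phi_range[of x] by simp

lemma phi_add: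
  assumes "x \<in> Z_inv n" "y \<in> Z_inv n"
  shows "phi n (x + y) = (phi n x + phi n y) mod int (n - 1)"
proof -
  obtain a b e where xy: "x = of_int a * real n powi e" "y = of_int b * real n powi e"
    using Z_inv_common_denominator[OF assms] by blast
  then have "x + y = of_int (a + b) * real n powi e" by (simp add: algebra_simps)
  then show ?thesis by (simp only: xy phi_eq mod_add_eq)
qed

lemma phi_mult:
  assumes "x \<in> Z_inv n" "y \<in> Z_inv n"
  shows "phi n (x * y) = (phi n x * phi n y) mod int (n - 1)"
proof -
  obtain a b c d where xy: "x = of_int a * real n powi b" "y = of_int c * real n powi d"
    using assms by (auto simp: Z_inv_def)
  then have "x * y = of_int (a * c) * real n powi (b + d)"
    using n2 by (simp add: power_int_add)
  then show ?thesis by (simp only: xy phi_eq mod_mult_eq)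
qed

lemma phi_power_mult:
  assumes "p \<in> powers_group n" "x \<in> Z_inv n"
  shows "phi n (p * x) = phi n x"
proof -
  obtain k where k: "p = real n powi k" using assms(1) by (auto simp: powers_group_def)
  obtain a b where x: "x = of_int a * real n powi b"
    using assms(2) by (auto simp: Z_inv_def)
  have "p * x = of_int a * real n powi (k + b)" using n2 by (simp add: k x power_int_add)
  then show ?thesis by (simp only: x phi_eq)
qed

lemma phi_multiple [simp]: "z \<in> Z_inv n \<Longrightarrow> phi n (real (n - 1) * z) = 0"
  using phi_mult[of "real (n - 1)" z] phi_int[of "int (n - 1)"] by simp

lemma powers_pos: "p \<in> powers_group n \<Longrightarrow> p > 0"
  using n2 by (auto simp: powers_group_def)

lemma powers_mult: "p \<in> powers_group n \<Longrightarrow> q \<in> powers_group n \<Longrightarrow> p * q \<in> powers_group n"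
  using n2 unfolding powers_group_def by (auto simp flip: power_int_add)

lemma powers_divide: "p \<in> powers_group n \<Longrightarrow> q \<in> powers_group n \<Longrightarrow> p / q \<in> powers_group n"
  by (simp add: divide_inverse powers_mult powers_inverse)

lemma nat_in_prime_divisors_group:
  assumes "k > 0" "\<And>p. Factorial_Ring.prime p \<Longrightarrow> p dvd k \<Longrightarrow> p dvd n"
  shows "real k \<in> prime_divisors_group n"
  using assms
proof (induction k rule: prime_divisors_induct)
  case (unit x)
  then show ?case using generate.one[of rat_units] by (simp add: prime_divisors_group_def)
next
  case (factor p x)
  then have "real p \<in> prime_divisors_group n"
    unfolding prime_divisors_group_def by (intro generate.incl) auto
  moreover have "real x \<in> prime_divisors_group n" using factor by auto
  ultimately show ?case
    using generate.eng[of "real p" rat_units _ "real x"] by (simp add: prime_divisors_group_def)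
qed simp

text \<open>If \<open>a n\<^sup>b\<close> and \<open>c n\<^sup>d\<close> are inverse to each other, then \<open>a\<close> divides a power of \<open>n\<close>, and so
  all prime factors of \<open>a\<close> divide \<open>n\<close>. This makes membership in the group a condition on the
  ring alone, which a homeomorphism preserving the ring can verify.\<close>

lemma prime_divisors_group_iff_unit:
  "s \<in> prime_divisors_group n \<longleftrightarrow> s > 0 \<and> s \<in> Z_inv n \<and> inverse s \<in> Z_inv n"
proof
  assume "s \<in> prime_divisors_group n"
  then show "s > 0 \<and> s \<in> Z_inv n \<and> inverse s \<in> Z_inv n"
    unfolding prime_divisors_group_def
  proof (induction rule: generate.induct)
    case one then show ?case by simp
  next
    case (incl h)
    then obtain p where p: "h = real p" "Factorial_Ring.prime p" "p dvd n" by blast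
    then have "inverse h = real (n div p) * real n powi (- 1)"
      using n2 by (simp add: power_int_minus real_of_nat_div field_simps)
    then have "inverse h \<in> Z_inv n" using Z_inv_mult Z_inv_powi Z_inv_nat by metis
    then show ?case using p by (simp add: prime_gt_0_nat)
  next
    case (inv h)
    then obtain p where p: "h = real p" "Factorial_Ring.prime p" "p dvd n" by blast
    then have "inverse h = real (n div p) * real n powi (- 1)"
      using n2 by (simp add: power_int_minus real_of_nat_div field_simps)
    then have "inverse h \<in> Z_inv n" using Z_inv_mult Z_inv_powi Z_inv_nat by metis
    moreover have "inv\<^bsub>rat_units\<^esub> h = inverse h"
      using p by (intro inv_rat_units) (auto simp: prime_gt_0_nat)
    ultimately show ?case using p by (simp add: prime_gt_0_nat)
  next
    case (eng h1 h2) then show ?case by (simp add: Z_inv_mult)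
  qed
next
  assume s: "s > 0 \<and> s \<in> Z_inv n \<and> inverse s \<in> Z_inv n"
  obtain a k where a: "s = of_int a / real n ^ k" using s n2 by (auto simp: Z_inv_iff)
  obtain c l where c: "inverse s = of_int c / real n ^ l" using s n2 by (auto simp: Z_inv_iff)
  have apos: "a > 0" using s n2 a by (simp add: zero_less_divide_iff)
  have "of_int a / real n ^ k * (of_int c / real n ^ l) = 1"
    unfolding a[symmetric] c[symmetric] using s by simp
  moreover have "real n ^ k * real n ^ l \<noteq> 0" using n2 by simp
  ultimately have "real_of_int (a * c) = of_int (int n ^ (k + l))"
    by (simp add: power_add)
  then have ac: "a * c = int n ^ (k + l)" by linarith
  have "real (nat a) \<in> prime_divisors_group n"
  proof (rule nat_in_prime_divisors_group)
    fix p assume p: "Factorial_Ring.prime p" "p dvd nat a"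
    have "int p dvd a" using p(2) apos int_dvd_int_iff[of p "nat a"] by simp
    then have "int p dvd int (n ^ (k + l))" using ac by (metis dvd_mult2 of_nat_power)
    then have "p dvd n ^ (k + l)" by (simp only: int_dvd_int_iff)
    then show "p dvd n" using p(1) prime_dvd_power by blast
  qed (use apos in simp)
  moreover have npow: "real (n ^ k) \<in> prime_divisors_group n"
    using n2 by (intro nat_in_prime_divisors_group) (auto dest: prime_dvd_power)
  moreover have "inv\<^bsub>rat_units\<^esub> (real (n ^ k)) = inverse (real (n ^ k))"
    using n2 by (intro inv_rat_units) auto
  moreover have "inv\<^bsub>rat_units\<^esub> (real (n ^ k)) \<in> prime_divisors_group n"
    using npow unfolding prime_divisors_group_def
    by (intro group.generate_m_inv_closed[OF group_rat_units])
       (auto simp: prime_gt_0_nat)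
  ultimately have "real (nat a) \<otimes>\<^bsub>rat_units\<^esub> inverse (real (n ^ k)) \<in> prime_divisors_group n"
    unfolding prime_divisors_group_def by (intro generate.eng) simp_all
  moreover have "real (nat a) * inverse (real (n ^ k)) = s"
    using apos by (simp add: a divide_inverse)
  ultimately show "s \<in> prime_divisors_group n" by (simp only: monoid_rat_units)
qed

section \<open>Homeomorphisms with slopes in a coset\<close>

text \<open>The maps \<open>h\<close> for which \<open>s h\<close> has slopes in \<open>\<langle>n\<rangle>\<close>; the case \<open>s = 1\<close> is \<open>A_R n\<close>. The constant is
  the inverse of a slope because of the semidirect product, where the second factor is twisted
  by the first: if \<open>h\<close> acts like \<open>x \<mapsto> m x + t\<close>, then following \<open>f\<close> by \<open>g\<close> multiplies the \<open>t\<close> of \<open>f\<close>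
  by the \<open>m\<close> of \<open>g\<close>, and passing to \<open>t / m\<close> and \<open>1 / m\<close> exchanges the two roles. Being
  affine at all points outside the ring says that the breaks are in the ring, and suffices to
  control the slopes, since these points are dense.\<close>

definition scaled_A :: "real \<Rightarrow> (real \<Rightarrow> real) set" where
  "scaled_A s = {h \<in> carrier HomeoR. strict_mono h \<and> PL h \<and> h ` Z_inv n = Z_inv n \<and>
     (\<forall>x. x \<notin> Z_inv n \<longrightarrow> (\<exists>p\<in>powers_group n. affine_at h x (p / s)))}"

lemma scaled_A_I:
  assumes "continuous_on UNIV f" "continuous_on UNIV g" "\<And>x. g (f x) = x" "\<And>y. f (g y) = y"
    "strict_mono f" "PL f"
    "\<And>x. x \<in> Z_inv n \<Longrightarrow> f x \<in> Z_inv n" "\<And>x. x \<in> Z_inv n \<Longrightarrow> g x \<in> Z_inv n"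
    "\<And>x. x \<notin> Z_inv n \<Longrightarrow> \<exists>p\<in>powers_group n. affine_at f x (p / s)"
  shows "f \<in> scaled_A s"
proof -
  have "f ` Z_inv n = Z_inv n" using assms(4,7,8) by (auto simp: image_iff) metis
  then show ?thesis using assms HomeoR_I[OF assms(1-4)] by (simp add: scaled_A_def)
qed

lemma scaled_A_affine_at:
  assumes "h \<in> scaled_A s" "x \<notin> Z_inv n"
  obtains p where "p \<in> powers_group n" "affine_at h x (p / s)"
  using assms unfolding scaled_A_def by blast

lemma scaled_A_preserves_ring:
  assumes "h \<in> scaled_A s" shows "h x \<in> Z_inv n \<longleftrightarrow> x \<in> Z_inv n"
proof -
  have "h ` Z_inv n = Z_inv n" "inj h"
    using assms by (auto simp: scaled_A_def strict_mono_imp_inj_on)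
  then show ?thesis by (metis inj_image_mem_iff)
qed

lemma scaled_A_compose:
  assumes "f \<in> scaled_A s" "g \<in> scaled_A t"
  shows "g \<circ> f \<in> scaled_A (s * t)"
proof -
  have "\<exists>p\<in>powers_group n. affine_at (g \<circ> f) x (p / (s * t))" if "x \<notin> Z_inv n" for x
  proof -
    obtain p where p: "p \<in> powers_group n" "affine_at f x (p / s)"
      using scaled_A_affine_at[OF assms(1) \<open>x \<notin> Z_inv n\<close>] .
    have "f x \<notin> Z_inv n" using scaled_A_preserves_ring[OF assms(1)] that by simp
    then obtain q where q: "q \<in> powers_group n" "affine_at g (f x) (q / t)"
      by (rule scaled_A_affine_at[OF assms(2)])
    have "affine_at (g \<circ> f) x (q * p / (s * t))"
      using affine_at_comp[OF p(2) q(2)] by (simp add: mult.commute)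
    then show ?thesis using powers_mult[OF q(1) p(1)] by blast
  qed
  moreover have "g ` f ` Z_inv n = Z_inv n" using assms by (simp add: scaled_A_def)
  then have "(g \<circ> f) ` Z_inv n = Z_inv n" by (simp only: image_comp)
  moreover have "strict_mono (g \<circ> f)" using assms by (auto simp: scaled_A_def strict_mono_def)
  ultimately show ?thesis
    using assms HomeoR_comp_closed PL_compose by (simp add: scaled_A_def)
qed

lemma scaled_A_inverse:
  assumes "f \<in> scaled_A s" "s \<noteq> 0"
  shows "inv_into UNIV f \<in> scaled_A (inverse s)"
proof -
  have f: "f \<in> carrier HomeoR" "strict_mono f" "PL f" using assms by (auto simp: scaled_A_def)
  show ?thesis
  proof (rule scaled_A_I[of _ f])
    show "\<exists>p\<in>powers_group n. affine_at (inv_into UNIV f) y (p / inverse s)" if "y \<notin> Z_inv n" for y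
    proof -
      define x where "x = inv_into UNIV f y"
      have y: "y = f x" using f by (simp add: x_def)
      then have "x \<notin> Z_inv n" using scaled_A_preserves_ring[OF assms(1)] that by simp
      then obtain p where p: "p \<in> powers_group n" "affine_at f x (p / s)"
        by (rule scaled_A_affine_at[OF assms(1)])
      have "affine_at (inv_into UNIV f) (f x) (1 / (p / s))"
        using f assms(2) powers_pos[OF p(1)]
        by (intro affine_at_inverse[OF p(2)])
           (auto simp: mem_HomeoR continuous_on_eq_continuous_at bij_is_surj bij_is_inj surj_f_inv_f)
      moreover have "1 / (p / s) = inverse p / inverse s" by (simp add: field_simps)
      ultimately show ?thesis using powers_inverse[OF p(1)] y by auto
    qed
    show "inv_into UNIV f x \<in> Z_inv n" if "x \<in> Z_inv n" for x
      using scaled_A_preserves_ring[OF assms(1), of "inv_into UNIV f x"] that f by simp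
  qed (use f scaled_A_preserves_ring[OF assms(1)] strict_mono_inv_HomeoR PL_inv_HomeoR
      in \<open>auto simp: mem_HomeoR bij_is_surj bij_is_inj surj_f_inv_f\<close>)
qed

lemma scaled_A_mult_power:
  assumes "p \<in> powers_group n" "f \<in> scaled_A s" shows "f \<in> scaled_A (p * s)"
proof -
  have "\<exists>r\<in>powers_group n. affine_at f x (r / (p * s))" if "x \<notin> Z_inv n" for x
  proof -
    obtain q where q: "q \<in> powers_group n" "affine_at f x (q / s)"
      using scaled_A_affine_at[OF assms(2) \<open>x \<notin> Z_inv n\<close>] .
    have "q / s = q * p / (p * s)" using powers_pos[OF assms(1)] by simp
    then show ?thesis using q powers_mult[OF q(1) assms(1)] by metis
  qed
  then show ?thesis using assms(2) by (simp add: scaled_A_def)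
qed

text \<open>The constant \<open>s\<close> is determined up to powers of \<open>n\<close>: compare slopes at one point outside the
  ring.\<close>

lemma scaled_A_ratio:
  assumes "f \<in> scaled_A s" "f \<in> scaled_A t" "s \<noteq> 0" "t \<noteq> 0"
  obtains p where "p \<in> powers_group n" "t = p * s"
proof -
  obtain x where "x \<notin> Z_inv n" using Z_inv_codense[of 0 1] by auto
  then obtain p q where pq: "p \<in> powers_group n" "affine_at f x (p / s)"
      "q \<in> powers_group n" "affine_at f x (q / t)"
    using scaled_A_affine_at[OF assms(1)] scaled_A_affine_at[OF assms(2)] by metis
  then have "p / s = q / t" using affine_at_unique by blast
  then have "t = q / p * s" using assms powers_pos[OF pq(1)] by (simp add: field_simps)
  then show thesis using that powers_divide[OF pq(3,1)] by blast
qed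

text \<open>Every open interval contains a point outside the ring, so the slope of an affine piece on
  the right of any \<open>x\<close>, in the ring or not, has the required form.\<close>

lemma right_slope_scaled_A:
  assumes "h \<in> scaled_A s" "e > 0" "\<And>y. y \<in> {x<..<x + e} \<Longrightarrow> h y = r * y + c"
  obtains p where "p \<in> powers_group n" "r = p / s"
proof -
  obtain y where y: "y \<notin> Z_inv n" "y \<in> {x<..<x + e}"
    using Z_inv_codense[of x "x + e"] assms(2) by auto
  then obtain p where "p \<in> powers_group n" "affine_at h y (p / s)"
    using scaled_A_affine_at[OF assms(1)] by blast
  moreover have "affine_at h y r" using affine_at_open_interval[OF y(2) assms(3)] .
  ultimately show thesis using that affine_at_unique by blast
qed

lemma A_R_eq_scaled_A: "A_R n = scaled_A 1"
proof (intro equalityI subsetI)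
  fix h assume h: "h \<in> A_R n"
  have "\<exists>p\<in>powers_group n. affine_at h x p" if "x \<notin> Z_inv n" for x
  proof -
    have "x \<notin> breaks h" "PL h" using h that by (auto simp: A_R_def)
    then obtain m where m: "affine_at h x m" using affine_at_if_not_break by blast
    then have "m \<in> slopes h" using affine_at_has_derivative by (auto simp: slopes_def)
    then show ?thesis using m h by (auto simp: A_R_def)
  qed
  then show "h \<in> scaled_A 1" using h by (auto simp: A_R_def scaled_A_def)
next
  fix h assume h: "h \<in> scaled_A 1"
  then have PL: "PL h" by (simp add: scaled_A_def)
  have "breaks h \<subseteq> Z_inv n"
    using h affine_at_not_break unfolding scaled_A_def by auto
  moreover have "m \<in> powers_group n" if m: "(h has_real_derivative m) (at x)" for m x
  proof -
    obtain e r where e: "e > 0" and r: "\<And>y. y \<in> {x..<x + e} \<Longrightarrow> h y = h x + r * (y - x)"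
      using PL_one_sided_affine[OF PL] by metis
    have "(h has_real_derivative m) (at x within {x<..})"
      using m by (rule has_field_derivative_at_within)
    then have "((\<lambda>y. (h y - h x) / (y - x)) \<longlongrightarrow> m) (at_right x)"
      by (simp add: has_field_derivative_iff)
    moreover have "(h y - h x) / (y - x) = r" if "x < y" "y < x + e" for y
      using r[of y] that by simp
    then have "\<forall>\<^sub>F y in at_right x. (h y - h x) / (y - x) = r"
      using e unfolding eventually_at_right_field by (intro exI[of _ "x + e"]) auto
    then have "((\<lambda>y. (h y - h x) / (y - x)) \<longlongrightarrow> r) (at_right x)" by (rule tendsto_eventually)
    ultimately have "m = r" using tendsto_unique[OF trivial_limit_at_right_real] by blast
    moreover obtain p where "p \<in> powers_group n" "r = p / 1"
      by (rule right_slope_scaled_A[OF h e, of x r "h x - r * x"])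
         (use r in \<open>auto simp: algebra_simps\<close>)
    ultimately show ?thesis by simp
  qed
  then have "slopes h \<subseteq> powers_group n" by (auto simp: slopes_def)
  ultimately show "h \<in> A_R n"
    using h discrete_breaks[OF PL] by (auto simp: A_R_def scaled_A_def)
qed

text \<open>On an affine piece of slope \<open>p / s\<close> with \<open>p\<close> a power of \<open>n\<close>, the difference
  \<open>s h(u) - s h(v) = p (u - v)\<close> has the same residue as \<open>u - v\<close>, so \<open>\<phi> (s h(u) - u)\<close> is constant on
  the ring points of the piece. Two pieces that meet at a point outside the ring are one piece,
  and two pieces that meet at a point of the ring have that point in common. So the residue is
  locally constant, and the claim follows because the line is connected and the ring is dense.\<close>

lemma phi_scaled_A_const:
  assumes h: "h \<in> scaled_A s" and s: "s \<in> prime_divisors_group n"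
    and "x \<in> Z_inv n" "y \<in> Z_inv n"
  shows "phi n (s * h x - x) = phi n (s * h y - y)"
proof -
  have s': "s > 0" "s \<in> Z_inv n" using s prime_divisors_group_iff_unit by auto
  have shZ: "s * h u - u \<in> Z_inv n" if "u \<in> Z_inv n" for u
    using that s'(2) scaled_A_preserves_ring[OF h] Z_inv_mult Z_inv_diff by blast
  have piece: "phi n (s * h u - u) = phi n (s * h v - v)"
    if "u \<in> Z_inv n" "v \<in> Z_inv n" "p \<in> powers_group n" "h u = h v + p / s * (u - v)" for u v p
  proof -
    define w where "w = u - v"
    have w: "w \<in> Z_inv n" "p * w \<in> Z_inv n"
      using that Z_inv_diff Z_inv_mult powers_subset_Z_inv by (auto simp: w_def)
    have "s * h u = s * h v + p * w"
      using s' by (simp add: that(4) w_def distrib_left)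
    then have "s * h u - u = (s * h v - v) + (p * w + - w)" by (simp add: w_def)
    moreover have "phi n (p * w + - w) = phi n (w + - w)"
      using w by (simp only: phi_add Z_inv_uminus phi_power_mult[OF that(3)])
    then have "phi n (p * w + - w) = 0" using phi_0 by simp
    ultimately show ?thesis
      using phi_add[OF shZ[OF that(2)] Z_inv_add[OF w(2) Z_inv_uminus[OF w(1)]]]
        phi_mod[OF shZ[OF that(2)]] by simp
  qed
  show ?thesis
  proof (rule connected_equivalence_relation_gen[of UNIV x y "\<lambda>u. u \<in> Z_inv n"
        "\<lambda>u v. phi n (s * h u - u) = phi n (s * h v - v)"])
    fix a
    show "\<exists>T. openin (top_of_set UNIV) T \<and> a \<in> T \<and>
      (\<forall>u\<in>T. \<forall>v\<in>T. u \<in> Z_inv n \<and> v \<in> Z_inv n \<longrightarrow> phi n (s * h u - u) = phi n (s * h v - v))"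
    proof (cases "a \<in> Z_inv n")
      case True
      have PL: "PL h" using h by (simp add: scaled_A_def)
      obtain e l r where e: "e > 0"
        and l: "\<And>y. y \<in> {a - e<..a} \<Longrightarrow> h y = h a + l * (y - a)"
        and r: "\<And>y. y \<in> {a..<a + e} \<Longrightarrow> h y = h a + r * (y - a)"
        using PL_one_sided_affine[OF PL] by blast
      obtain p where p: "p \<in> powers_group n" "l = p / s"
        by (rule right_slope_scaled_A[OF h e, of "a - e" l "h a - l * a"])
           (use l in \<open>auto simp: algebra_simps\<close>)
      obtain q where q: "q \<in> powers_group n" "r = q / s"
        by (rule right_slope_scaled_A[OF h e, of a r "h a - r * a"])
           (use r in \<open>auto simp: algebra_simps\<close>)
      have "phi n (s * h u - u) = phi n (s * h a - a)"
        if "u \<in> {a - e<..<a + e}" "u \<in> Z_inv n" for u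
      proof (cases "u \<le> a")
        case True
        then have "h u = h a + p / s * (u - a)" using that l[of u] p(2) by simp
        then show ?thesis by (rule piece[OF that(2) \<open>a \<in> Z_inv n\<close> p(1)])
      next
        case False
        then have "h u = h a + q / s * (u - a)" using that r[of u] q(2) by simp
        then show ?thesis by (rule piece[OF that(2) \<open>a \<in> Z_inv n\<close> q(1)])
      qed
      then show ?thesis using e by (intro exI[of _ "{a - e<..<a + e}"]) auto
    next
      case False
      then obtain p where p: "p \<in> powers_group n" "affine_at h a (p / s)"
        by (rule scaled_A_affine_at[OF h])
      then obtain e where e: "e > 0" "\<And>y. \<bar>y - a\<bar> < e \<Longrightarrow> h y = h a + p / s * (y - a)"
        unfolding affine_at_iff by blast
      have "phi n (s * h u - u) = phi n (s * h v - v)"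
        if "u \<in> {a - e<..<a + e}" "v \<in> {a - e<..<a + e}" "u \<in> Z_inv n" "v \<in> Z_inv n" for u v
      proof (rule piece[OF that(3,4) p(1)])
        have "h u = h a + p / s * (u - a)" "h v = h a + p / s * (v - a)"
          using that e(2)[of u] e(2)[of v] by (simp_all add: abs_less_iff)
        then show "h u = h v + p / s * (u - v)" by (simp add: right_diff_distrib)
      qed
      then show ?thesis using e
        by (intro exI[of _ "{a - e<..<a + e}"] conjI ballI impI) (blast | simp)+
    qed
  next
    fix T :: "real set" and a assume "openin (top_of_set UNIV) T" "a \<in> T"
    then obtain e where "e > 0" "ball a e \<subseteq> T" by (auto simp: open_contains_ball)
    moreover obtain z where "z \<in> Z_inv n" "a < z" "z < a + e"
      using Z_inv_dense[of a "a + e"] \<open>e > 0\<close> by auto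
    ultimately show "\<exists>z. z \<in> T \<and> z \<in> Z_inv n"
      by (intro exI[of _ z]) (auto simp: dist_real_def subset_iff)
  qed (use assms in auto)
qed

lemma phi_scaled_A:
  assumes h: "h \<in> scaled_A s" and s: "s \<in> prime_divisors_group n" and x: "x \<in> Z_inv n"
  shows "phi n (s * h x) = (phi n x + phi n (s * h 0)) mod int (n - 1)"
proof -
  have "s \<in> Z_inv n" using s prime_divisors_group_iff_unit by auto
  then have "s * h x - x \<in> Z_inv n"
    using x scaled_A_preserves_ring[OF h] Z_inv_mult Z_inv_diff by blast
  then have "phi n (s * h x) = (phi n x + phi n (s * h x - x)) mod int (n - 1)"
    using phi_add[OF x] by fastforce
  also have "phi n (s * h x - x) = phi n (s * h 0)"
    using phi_scaled_A_const[OF h s x, of 0] n2 by simp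
  finally show ?thesis .
qed

lemma B_R_eq: "B_R n = {f \<in> scaled_A 1. phi n (f 0) = 0}"
proof -
  have 1: "1 \<in> prime_divisors_group n" using prime_divisors_group_iff_unit n2 by simp
  have "rho n f = phi n (f 0)" if f: "f \<in> scaled_A 1" for f
  proof -
    have f0: "f 0 \<in> Z_inv n" using scaled_A_preserves_ring[OF f] n2 by simp
    have "(phi n (f x) - phi n x) mod int (n - 1) = phi n (f 0)" if "x \<in> Z_inv n" for x
      using phi_scaled_A[OF f 1 that] phi_mod[OF f0] by (simp add: mod_simps)
    then show ?thesis unfolding rho_def
      using Z_inv_0 by (intro the_equality) metis+
  qed
  then show ?thesis unfolding B_R_def kernel_def by (auto simp: A_R_eq_scaled_A)
qed

section \<open>The normalizer\<close>

lemma hinge_in_scaled_A: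
  assumes "m \<in> powers_group n" "x \<in> Z_inv n" shows "hinge m x \<in> scaled_A 1"
proof (rule scaled_A_I[of _ "hinge (inverse m) x"])
  have m: "m > 0" using powers_pos[OF assms(1)] .
  show "hinge (inverse m) x (hinge m x t) = t" for t using hinge_inverse[OF m] .
  show "hinge m x (hinge (inverse m) x t) = t" for t using hinge_inverse[of "inverse m"] m by simp
  show "strict_mono (hinge m x)" using strict_mono_hinge[OF m] .
  have closed: "hinge k x t \<in> Z_inv n" if "k \<in> powers_group n" "t \<in> Z_inv n" for k t
    using that assms(2) powers_subset_Z_inv[OF that(1)]
    by (cases "t \<le> x") (simp_all add: hinge_simps n2 Z_inv_add Z_inv_mult Z_inv_diff)
  show "hinge m x t \<in> Z_inv n" if "t \<in> Z_inv n" for t using closed[OF assms(1) that] .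
  show "hinge (inverse m) x t \<in> Z_inv n" if "t \<in> Z_inv n" for t
    using closed[OF powers_inverse[OF assms(1)] that] .
  show "\<exists>p\<in>powers_group n. affine_at (hinge m x) t (p / 1)" if "t \<notin> Z_inv n" for t
  proof -
    have "t < x \<or> x < t" using that assms(2) by (metis linorder_neqE)
    then show ?thesis
    proof
      assume "t < x"
      then have "affine_at (hinge m x) t 1"
        by (intro affine_at_open_interval[of _ "t - 1" x _ _ 0]) (auto simp: hinge_simps)
      then show ?thesis using powers_1 by auto
    next
      assume "x < t"
      then have "affine_at (hinge m x) t m"
        by (intro affine_at_open_interval[of _ x "t + 1" _ _ "x - m * x"])
           (auto simp: hinge_simps algebra_simps)
      then show ?thesis using assms(1) by auto
    qed
  qed
qed (auto simp: continuous_hinge PL_hinge)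

text \<open>The map fixes the ring element \<open>x\<close>, so its shift vanishes there and hence everywhere.\<close>

lemma hinge_in_B:
  assumes "m \<in> powers_group n" "x \<in> Z_inv n" shows "hinge m x \<in> B_R n"
proof -
  have f: "hinge m x \<in> scaled_A 1" using hinge_in_scaled_A[OF assms] .
  have 1: "1 \<in> prime_divisors_group n" using prime_divisors_group_iff_unit n2 by simp
  have "0 \<le> phi n (hinge m x 0)" "phi n (hinge m x 0) < int (n - 1)"
    using phi_range[of "hinge m x 0"] scaled_A_preserves_ring[OF f] n2 by auto
  moreover have "phi n x = (phi n x + phi n (hinge m x 0)) mod int (n - 1)"
    using phi_scaled_A[OF f 1 assms(2)] by (simp add: hinge_simps)
  ultimately have "phi n (hinge m x 0) = 0"
    using phi_mod[OF assms(2)]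
    by (metis add.right_neutral cong_add_lcancel cong_def mod_pos_pos_trivial mod_0)
  then show ?thesis using f by (simp add: B_R_eq)
qed

lemma similarity_in_scaled_A:
  assumes s: "s \<in> prime_divisors_group n" and a: "a \<in> Z_inv n"
  shows "(\<lambda>x. (x + a) / s) \<in> scaled_A s"
proof (rule scaled_A_I[of _ "\<lambda>y. s * y - a"])
  have s': "s > 0" "s \<in> Z_inv n" "inverse s \<in> Z_inv n"
    using s prime_divisors_group_iff_unit by auto
  show "strict_mono (\<lambda>x. (x + a) / s)"
    using s' by (intro strict_monoI) (simp add: divide_strict_right_mono)
  have "(\<lambda>x. (x + a) / s) = (\<lambda>x. inverse s * x + a / s)"
    by (simp add: fun_eq_iff add_divide_distrib) (simp add: divide_inverse mult.commute)
  then show "PL (\<lambda>x. (x + a) / s)" by (simp only: PL_affine)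
  show "(x + a) / s \<in> Z_inv n" "s * x - a \<in> Z_inv n" if "x \<in> Z_inv n" for x
    using that s' a by (simp_all add: divide_inverse n2 Z_inv_add Z_inv_mult Z_inv_diff)
  have "affine_at (\<lambda>x. (x + a) / s) x (1 / s)" for x
    by (rule affine_at_open_interval[of _ "x - 1" "x + 1" _ _ "a / s"]) (auto simp: add_divide_distrib)
  then show "\<exists>p\<in>powers_group n. affine_at (\<lambda>x. (x + a) / s) x (p / s)" for x
    using powers_1 by blast
  show "continuous_on UNIV (\<lambda>x. (x + a) / s)" using s' by (intro continuous_intros) auto
qed (use prime_divisors_group_iff_unit[of s] s in \<open>auto intro!: continuous_intros\<close>)

lemma translation_in_B:
  assumes "z \<in> Z_inv n" shows "(\<lambda>x. x + real (n - 1) * z) \<in> B_R n"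
proof -
  have 1: "1 \<in> prime_divisors_group n" using prime_divisors_group_iff_unit n2 by simp
  have "real (n - 1) * z \<in> Z_inv n" using assms Z_inv_mult Z_inv_nat by blast
  then have "(\<lambda>x. x + real (n - 1) * z) \<in> scaled_A 1"
    using similarity_in_scaled_A[OF 1] by simp
  then show ?thesis using phi_multiple[OF assms] by (simp add: B_R_eq)
qed

text \<open>The conjugate is the identity on the left of \<open>h x\<close>. If \<open>h x\<close> were not in the ring, the conjugate
  would be affine near \<open>h x\<close>, hence the identity on the right as well; but the hinge moves every
  point on the right of \<open>x\<close>.\<close>

lemma ring_point_mapped_to_ring:
  assumes h: "h \<in> carrier HomeoR" "strict_mono h" and x: "x \<in> Z_inv n"
    and conj: "h \<circ> hinge (real n) x \<circ> inv_into UNIV h \<in> A_R n"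
  shows "h x \<in> Z_inv n"
proof (rule ccontr)
  define g where "g = h \<circ> hinge (real n) x \<circ> inv_into UNIV h"
  define k where "k = inv_into UNIV h"
  have k: "h (k y) = y" "k (h y) = y" for y using h(1) by (simp_all add: k_def)
  assume "h x \<notin> Z_inv n"
  moreover have "g \<in> scaled_A 1" using conj A_R_eq_scaled_A by (simp add: g_def)
  ultimately obtain p where "affine_at g (h x) (p / 1)" using scaled_A_affine_at by metis
  then obtain e where e: "e > 0" and aff: "\<And>y. \<bar>y - h x\<bar> < e \<Longrightarrow> g y = g (h x) + p * (y - h x)"
    unfolding affine_at_iff by auto
  have ghx: "g (h x) = h x" using k by (simp add: g_def k_def[symmetric] hinge_simps)
  have kless: "k y < k z \<longleftrightarrow> y < z" for y z
    using strict_mono_less[OF h(2), of "k y" "k z"] k by simp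
  have "g (h x - e / 2) = h x - e / 2"
    using kless[of "h x - e / 2" "h x"] e k by (simp add: g_def k_def[symmetric] hinge_simps)
  moreover have "g (h x - e / 2) = h x + p * (- e / 2)" using aff[of "h x - e / 2"] e ghx by simp
  ultimately have "h x - e / 2 = h x + p * (- e / 2)" by (simp only:)
  then have "(p - 1) * e = 0" by (simp add: algebra_simps)
  then have "p = 1" using e by simp
  define t where "t = k (h x + e / 2)"
  have "g (h x + e / 2) = h x + e / 2" using aff[of "h x + e / 2"] e ghx \<open>p = 1\<close> by simp
  then have "h (hinge (real n) x t) = h t" by (simp add: g_def t_def k_def[symmetric] k)
  then have "hinge (real n) x t = t" using k(2) by metis
  moreover have "x < t" using kless[of "h x" "h x + e / 2"] e k by (simp add: t_def)
  ultimately have "(real n - 1) * (t - x) = 0" by (simp add: hinge_simps algebra_simps)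
  then show False using \<open>x < t\<close> n2 by simp
qed

text \<open>The slope \<open>r\<close> of \<open>h\<close> just to the right of \<open>0\<close> serves as reference. A translation by
  \<open>d \<in> (n - 1) \<int>[1/n]\<close> carries a given \<open>x\<close> outside the ring to where \<open>h\<close> has slope \<open>r\<close>; if \<open>g\<close> is the
  conjugate by \<open>h\<close> of the inverse translation, then \<open>h(y) = g(h(y + d))\<close>, which is affine near \<open>x\<close>
  with slope in \<open>r\<langle>n\<rangle>\<close>.\<close>

lemma scaled_A_if_normalizes:
  assumes h: "h \<in> carrier HomeoR" "strict_mono h" "PL h"
    and conj: "\<And>f. f \<in> B_R n \<Longrightarrow> h \<circ> f \<circ> inv_into UNIV h \<in> A_R n"
    and conj': "\<And>f. f \<in> B_R n \<Longrightarrow> inv_into UNIV h \<circ> f \<circ> h \<in> A_R n"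
  obtains s where "s \<in> prime_divisors_group n" "h \<in> scaled_A s"
proof -
  define k where "k = inv_into UNIV h"
  have k: "h (k y) = y" "k (h y) = y" for y using h(1) by (simp_all add: k_def)
  have hZ: "h x \<in> Z_inv n" if "x \<in> Z_inv n" for x
    using ring_point_mapped_to_ring[OF h(1,2) that] conj hinge_in_B[OF powers_n that] by blast
  have kZ: "k x \<in> Z_inv n" if "x \<in> Z_inv n" for x
  proof -
    have "inv_into UNIV k = h" using h(1) by (simp add: k_def mem_HomeoR inv_inv_eq)
    then show ?thesis
      using ring_point_mapped_to_ring[OF HomeoR_inv_closed strict_mono_inv_HomeoR, OF h(1) h(1,2) that]
        conj'[OF hinge_in_B[OF powers_n that]] by (simp add: k_def)
  qed
  have hZ': "h x \<in> Z_inv n \<longleftrightarrow> x \<in> Z_inv n" for x using hZ[of x] kZ[of "h x"] k by auto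
  obtain e r where e: "e > 0" and r: "\<And>y. y \<in> {0..<0 + e} \<Longrightarrow> h y = h 0 + r * (y - 0)"
    using PL_one_sided_affine[OF h(3), of 0] by metis
  have "h 0 < h (e / 2)" using h(2) e by (simp add: strict_mono_less)
  then have "r * e > 0" using r[of "e / 2"] e by simp
  then have rpos: "r > 0" using e by (simp add: zero_less_mult_iff)
  have h0: "h 0 \<in> Z_inv n" using hZ n2 by simp
  \<comment> \<open>A ring element \<open>w\<close> so small that \<open>0, w\<close> and \<open>h 0, h 0 + w\<close> lie on the piece of slope \<open>r\<close> and on
    its image: the first pair shows that \<open>r\<close>, the second that \<open>1 / r\<close> is in the ring.\<close>
  obtain j where j: "1 / min e (r * e) < real n ^ j"
    using real_arch_pow[of "real n"] n2 by auto
  define w where "w = real n powi (- int j)"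
  have wpos: "w > 0" using n2 by (simp add: w_def)
  have "inverse (real n ^ j) < inverse (1 / min e (r * e))"
    using e \<open>r * e > 0\<close> by (intro less_imp_inverse_less[OF j]) auto
  then have w1: "w < e" "w < r * e" by (simp_all add: w_def power_int_minus)
  have "inverse w = real n powi int j" by (simp add: w_def power_int_minus)
  then have wZ: "w \<in> Z_inv n" "inverse w \<in> Z_inv n"
    using Z_inv_powi by (simp_all only: w_def)
  have "h w = h 0 + r * w" using r[of w] w1 wpos by simp
  then have "r = inverse w * (h w - h 0)" using wpos by simp
  then have rZ: "r \<in> Z_inv n" using Z_inv_mult[OF wZ(2)] Z_inv_diff[OF hZ[OF wZ(1)] h0] by metis
  have "h (w / r) = h 0 + w" using r[of "w / r"] w1 wpos rpos by (simp add: field_simps)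
  then have "w / r \<in> Z_inv n" using hZ'[of "w / r"] Z_inv_add[OF h0 wZ(1)] by simp
  then have "inverse w * (w / r) \<in> Z_inv n" using Z_inv_mult[OF wZ(2)] by blast
  then have "inverse r \<in> Z_inv n" using wpos by (simp add: field_simps)
  then have unit: "inverse r \<in> prime_divisors_group n"
    using rZ rpos prime_divisors_group_iff_unit by simp
  have "h \<in> scaled_A (inverse r)"
  proof (rule scaled_A_I[of _ k])
    fix x assume x: "x \<notin> Z_inv n"
    obtain z where z: "z \<in> Z_inv n" "- x < real (n - 1) * z" "real (n - 1) * z < e - x"
      using Z_inv_multiples_dense[of "- x" "e - x"] e by auto
    define d where "d = real (n - 1) * z"
    have d: "d \<in> Z_inv n" "0 < x + d" "x + d < e"
      using z Z_inv_mult[OF Z_inv_nat] by (auto simp: d_def)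
    have "affine_at h (x + d) r"
    proof (rule affine_at_open_interval[of _ 0 e _ _ "h 0"])
      show "h y = r * y + h 0" if "y \<in> {0<..<e}" for y using r[of y] that by simp
    qed (use d in simp)
    moreover have "affine_at (\<lambda>y. y + d) x 1"
      by (rule affine_at_open_interval[of _ "x - 1" "x + 1" _ _ d]) auto
    ultimately have hd: "affine_at (h \<circ> (\<lambda>y. y + d)) x (r * 1)" by (intro affine_at_comp)
    define g where "g = h \<circ> (\<lambda>y. y + real (n - 1) * (- z)) \<circ> inv_into UNIV h"
    have "g \<in> scaled_A 1"
      using conj[OF translation_in_B[OF Z_inv_uminus[OF z(1)]]] A_R_eq_scaled_A
      by (simp add: g_def)
    moreover have "h (x + d) \<notin> Z_inv n"
    proof
      assume "h (x + d) \<in> Z_inv n"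
      then have "(x + d) - d \<in> Z_inv n" using hZ' Z_inv_diff d(1) by blast
      then show False using x by simp
    qed
    ultimately obtain p where p: "p \<in> powers_group n" "affine_at g (h (x + d)) (p / 1)"
      using scaled_A_affine_at by metis
    have "affine_at (g \<circ> (h \<circ> (\<lambda>y. y + d))) x (p / 1 * (r * 1))"
      using affine_at_comp[OF hd] p(2) by simp
    moreover have "g \<circ> (h \<circ> (\<lambda>y. y + d)) = h"
      using k by (auto simp: g_def k_def[symmetric] d_def)
    ultimately show "\<exists>p\<in>powers_group n. affine_at h x (p / inverse r)"
      using p(1) by (intro bexI[of _ p]) (simp_all add: field_simps)
  qed (use h k hZ kZ in \<open>auto simp: k_def mem_HomeoR\<close>)
  then show thesis using that unit by blast
qed

section \<open>The outer automorphism groups\<close>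

text \<open>The name is justified by lemma \<open>Aut_PL_eq_PL_normalizer\<close>.\<close>

definition PL_normalizer :: "(real \<Rightarrow> real) set" where
  "PL_normalizer = (\<Union>s\<in>prime_divisors_group n. scaled_A s)"

definition powers_coset :: "real \<Rightarrow> real set" where
  "powers_coset s = (\<lambda>p. p * s) ` powers_group n"

text \<open>The shift is the constant value of \<open>\<phi> (s h(x)) - \<phi> x\<close> on the ring, taken at \<open>x = 0\<close>; the pair
  depends on \<open>h\<close> only, since \<open>s\<close> is unique up to powers of \<open>n\<close>.\<close>

definition shift_and_scale :: "(real \<Rightarrow> real) \<Rightarrow> int \<times> real set" where
  "shift_and_scale h = (THE r. \<exists>s\<in>prime_divisors_group n.
     h \<in> scaled_A s \<and> r = (phi n (s * h 0), powers_coset s))"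

lemma prime_divisors_group_units:
  assumes "s \<in> prime_divisors_group n"
  shows "s > 0" "s \<in> Z_inv n" "inverse s \<in> Z_inv n"
  using assms prime_divisors_group_iff_unit by auto

lemma prime_divisors_group_closed:
  "1 \<in> prime_divisors_group n"
  "s \<in> prime_divisors_group n \<Longrightarrow> t \<in> prime_divisors_group n \<Longrightarrow> s * t \<in> prime_divisors_group n"
  "s \<in> prime_divisors_group n \<Longrightarrow> inverse s \<in> prime_divisors_group n"
  by (simp_all add: prime_divisors_group_iff_unit Z_inv_mult n2)

lemma powers_coset_mult_power:
  assumes "p \<in> powers_group n" shows "powers_coset (p * s) = powers_coset s"
proof
  show "powers_coset (p * s) \<subseteq> powers_coset s"
    unfolding powers_coset_def using powers_mult[OF _ assms] by (auto simp: mult.assoc[symmetric])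
  have "q * s \<in> powers_coset (p * s)" if "q \<in> powers_group n" for q
  proof -
    have "q * s = (q / p) * (p * s)" using powers_pos[OF assms] by simp
    then show ?thesis using powers_divide[OF that assms] unfolding powers_coset_def by blast
  qed
  then show "powers_coset s \<subseteq> powers_coset (p * s)" unfolding powers_coset_def[of s] by blast
qed

lemma mem_powers_coset: "s \<in> powers_coset s"
  unfolding powers_coset_def using powers_1 by force

lemma quotient_simps:
  "carrier (prime_divisors_quotient n) = powers_coset ` prime_divisors_group n"
  "\<one>\<^bsub>prime_divisors_quotient n\<^esub> = powers_coset 1"
  by (auto simp: prime_divisors_quotient_def FactGroup_def RCOSETS_def r_coset_def powers_coset_def
      UNION_singleton_eq_range)

lemma quotient_mult:
  "powers_coset s \<otimes>\<^bsub>prime_divisors_quotient n\<^esub> powers_coset t = powers_coset (s * t)"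
proof -
  have "(p * s) * (q * t) \<in> powers_coset (s * t)"
    if "p \<in> powers_group n" "q \<in> powers_group n" for p q
    using powers_mult[OF that] unfolding powers_coset_def
    by (intro image_eqI[of _ _ "p * q"]) simp_all
  moreover have "p * (s * t) \<in> powers_coset s <#>\<^bsub>rat_units\<^esub> powers_coset t"
    if "p \<in> powers_group n" for p
  proof -
    have "p * s \<in> powers_coset s" using that unfolding powers_coset_def by blast
    moreover have "p * (s * t) = (p * s) \<otimes>\<^bsub>rat_units\<^esub> t" by simp
    ultimately show ?thesis using mem_powers_coset[of t] unfolding set_mult_def by blast
  qed
  ultimately have "powers_coset s <#>\<^bsub>rat_units\<^esub> powers_coset t = powers_coset (s * t)"
    unfolding powers_coset_def set_mult_def by auto
  then show ?thesis
    by (simp add: prime_divisors_quotient_def FactGroup_def set_mult_def)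
qed

lemma coset_action_eq:
  assumes "s \<in> prime_divisors_group n"
  shows "coset_action n (powers_coset s) a = (phi n s * a) mod int (n - 1)"
proof -
  have phi: "phi n t = phi n s" if "t \<in> powers_coset s" for t
    using that phi_power_mult[OF _ prime_divisors_group_units(2)[OF assms]]
    by (auto simp: powers_coset_def)
  show ?thesis
    unfolding coset_action_def
  proof (rule the_equality)
    show "\<exists>t\<in>powers_coset s. (phi n s * a) mod int (n - 1) = (phi n t * a) mod int (n - 1)"
      using mem_powers_coset by blast
    fix r assume "\<exists>t\<in>powers_coset s. r = (phi n t * a) mod int (n - 1)"
    then obtain t where "t \<in> powers_coset s" "r = (phi n t * a) mod int (n - 1)" by blast
    then show "r = (phi n s * a) mod int (n - 1)" using phi[of t] by simp
  qed
qed

lemma shift_and_scale_eq: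
  assumes "s \<in> prime_divisors_group n" "h \<in> scaled_A s"
  shows "shift_and_scale h = (phi n (s * h 0), powers_coset s)"
  unfolding shift_and_scale_def
proof (rule the_equality)
  fix r assume "\<exists>t\<in>prime_divisors_group n. h \<in> scaled_A t \<and> r = (phi n (t * h 0), powers_coset t)"
  then obtain t where t: "t \<in> prime_divisors_group n" "h \<in> scaled_A t"
    and r: "r = (phi n (t * h 0), powers_coset t)" by blast
  obtain p where p: "p \<in> powers_group n" "t = p * s"
    using scaled_A_ratio[OF assms(2) t(2)] prime_divisors_group_units(1) assms(1) t(1)
    by (metis less_irrefl)
  have "s * h 0 \<in> Z_inv n"
    using Z_inv_mult[OF prime_divisors_group_units(2)[OF assms(1)]]
      scaled_A_preserves_ring[OF assms(2)] n2 by simp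
  then show "r = (phi n (s * h 0), powers_coset s)"
    using r p phi_power_mult[OF p(1)] powers_coset_mult_power[OF p(1)] by (simp add: mult.assoc)
qed (use assms in blast)

lemma subgroup_PL_normalizer: "subgroup PL_normalizer HomeoR"
proof (rule group.subgroupI[OF group_HomeoR])
  show sub: "PL_normalizer \<subseteq> carrier HomeoR"
    by (auto simp: PL_normalizer_def scaled_A_def)
  show "PL_normalizer \<noteq> {}"
    using similarity_in_scaled_A[of 1 0] prime_divisors_group_closed(1) n2
    by (auto simp: PL_normalizer_def)
  fix f assume "f \<in> PL_normalizer"
  then obtain s where s: "s \<in> prime_divisors_group n" "f \<in> scaled_A s"
    by (auto simp: PL_normalizer_def)
  then have "inv_into UNIV f \<in> scaled_A (inverse s)"
    using scaled_A_inverse prime_divisors_group_units(1)[OF s(1)] by simp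
  moreover have "f \<in> carrier HomeoR" using s(2) by (simp add: scaled_A_def)
  ultimately show "inv\<^bsub>HomeoR\<^esub> f \<in> PL_normalizer"
    using s(1) prime_divisors_group_closed(3) by (auto simp: HomeoR_m_inv PL_normalizer_def)
  fix g assume "g \<in> PL_normalizer"
  then obtain t where t: "t \<in> prime_divisors_group n" "g \<in> scaled_A t"
    by (auto simp: PL_normalizer_def)
  show "f \<otimes>\<^bsub>HomeoR\<^esub> g \<in> PL_normalizer"
    using scaled_A_compose[OF s(2) t(2)] prime_divisors_group_closed(2)[OF s(1) t(1)]
    by (auto simp: PL_normalizer_def)
qed

abbreviation (input) "extension \<equiv> semidirect_product (integer_mod_group (n - 1)) (prime_divisors_quotient n)
  (coset_action n)"

abbreviation (input) "auts \<equiv> HomeoR\<lparr>carrier := PL_normalizer\<rparr>"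

lemma shift_in_ring:
  assumes "s \<in> prime_divisors_group n" "h \<in> scaled_A s" "x \<in> Z_inv n"
  shows "h x \<in> Z_inv n" "s * h x \<in> Z_inv n"
  using scaled_A_preserves_ring[OF assms(2)] assms(3)
    Z_inv_mult[OF prime_divisors_group_units(2)[OF assms(1)]] by auto

text \<open>With \<open>f\<close> first and \<open>g\<close> second, \<open>\<phi> (s t g(f(0))) = \<phi> s \<cdot> (\<phi> (f(0)) + \<phi> (t g(0)))\<close>, where \<open>s\<close>
  and \<open>t\<close> belong to \<open>f\<close> and \<open>g\<close>: the shift of \<open>g\<close> is twisted by the scale of \<open>f\<close>.\<close>

lemma shift_and_scale_hom: "shift_and_scale \<in> hom auts extension"
proof (rule homI)
  fix f assume "f \<in> carrier auts"
  then obtain s where s: "s \<in> prime_divisors_group n" "f \<in> scaled_A s"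
    by (auto simp: PL_normalizer_def)
  then show "shift_and_scale f \<in> carrier extension"
    using phi_range[OF shift_in_ring(2)[OF s Z_inv_0]] n2
    by (simp add: shift_and_scale_eq semidirect_simps quotient_simps carrier_integer_mod_group)
next
  fix f g assume "f \<in> carrier auts" "g \<in> carrier auts"
  then obtain s t where s: "s \<in> prime_divisors_group n" "f \<in> scaled_A s"
    and t: "t \<in> prime_divisors_group n" "g \<in> scaled_A t"
    by (auto simp: PL_normalizer_def)
  have sZ: "s \<in> Z_inv n" using prime_divisors_group_units[OF s(1)] by simp
  note f0 = shift_in_ring[OF s Z_inv_0] and g0 = shift_in_ring[OF t Z_inv_0]
  have "phi n (s * t * g (f 0)) = phi n s * phi n (t * g (f 0)) mod int (n - 1)"
    using phi_mult[OF sZ shift_in_ring(2)[OF t f0(1)]] by (simp add: mult.assoc)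
  also have "\<dots> = (phi n s * phi n (f 0) + phi n s * phi n (t * g 0)) mod int (n - 1)"
    using phi_scaled_A[OF t(2,1) f0(1)] by (simp add: mod_simps distrib_left)
  also have "\<dots> = (phi n (s * f 0) + phi n s * phi n (t * g 0) mod int (n - 1)) mod int (n - 1)"
    using phi_mult[OF sZ f0(1)] by (simp add: mod_simps)
  finally show "shift_and_scale (f \<otimes>\<^bsub>auts\<^esub> g) =
      shift_and_scale f \<otimes>\<^bsub>extension\<^esub> shift_and_scale g"
    using s t scaled_A_compose[OF s(2) t(2)] prime_divisors_group_closed(2)[OF s(1) t(1)]
    by (simp add: shift_and_scale_eq semidirect_simps quotient_mult coset_action_eq)
qed

lemma shift_and_scale_onto: "shift_and_scale ` carrier auts = carrier extension"
proof
  show "shift_and_scale ` carrier auts \<subseteq> carrier extension"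
    using shift_and_scale_hom by (auto simp: hom_def)
  show "carrier extension \<subseteq> shift_and_scale ` carrier auts"
  proof
    fix r assume "r \<in> carrier extension"
    then obtain a s where s: "s \<in> prime_divisors_group n" and a: "0 \<le> a" "a < int (n - 1)"
      and r: "r = (a, powers_coset s)"
      using n2 by (auto simp: semidirect_simps quotient_simps carrier_integer_mod_group)
    define h where "h = (\<lambda>x. (x + of_int a) / s)"
    have h: "h \<in> scaled_A s" using similarity_in_scaled_A[OF s Z_inv_int] by (simp add: h_def)
    have "s * h 0 = of_int a" using prime_divisors_group_units(1)[OF s] by (simp add: h_def)
    then have "shift_and_scale h = r"
      using a phi_int[of a] by (simp add: shift_and_scale_eq[OF s h] r)
    moreover have "h \<in> carrier auts" using s h by (auto simp: PL_normalizer_def)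
    ultimately show "r \<in> shift_and_scale ` carrier auts" by blast
  qed
qed

lemma id_in_scaled_A: "id \<in> scaled_A 1"
  using similarity_in_scaled_A[OF prime_divisors_group_closed(1) Z_inv_0] by (simp add: id_def)

lemma shift_and_scale_one: "shift_and_scale \<one>\<^bsub>auts\<^esub> = \<one>\<^bsub>extension\<^esub>"
  using n2 by (simp add: shift_and_scale_eq[OF prime_divisors_group_closed(1) id_in_scaled_A]
      semidirect_simps quotient_simps)

lemma powers_coset_eq_1_iff: "powers_coset s = powers_coset 1 \<longleftrightarrow> s \<in> powers_group n"
  using mem_powers_coset[of s] powers_coset_mult_power[of s 1] by (auto simp: powers_coset_def)

lemma PL_normalizer_trivial_scale:
  assumes "f \<in> PL_normalizer" "snd (shift_and_scale f) = powers_coset 1"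
  shows "f \<in> scaled_A 1"
proof -
  obtain s where s: "s \<in> prime_divisors_group n" "f \<in> scaled_A s"
    using assms(1) by (auto simp: PL_normalizer_def)
  then have "s \<in> powers_group n" using assms(2) by (simp add: shift_and_scale_eq powers_coset_eq_1_iff)
  then have "f \<in> scaled_A (inverse s * s)"
    using scaled_A_mult_power[OF powers_inverse s(2)] by blast
  then show ?thesis using prime_divisors_group_units(1)[OF s(1)] by simp
qed

lemma kernel_scale: "kernel auts (prime_divisors_quotient n) (snd \<circ> shift_and_scale) = A_R n"
  using PL_normalizer_trivial_scale prime_divisors_group_closed(1)
  by (auto simp: kernel_def A_R_eq_scaled_A quotient_simps PL_normalizer_def
      shift_and_scale_eq[OF prime_divisors_group_closed(1)])

lemma kernel_shift_and_scale: "kernel auts extension shift_and_scale = B_R n"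
proof (intro equalityI subsetI)
  fix f assume f: "f \<in> kernel auts extension shift_and_scale"
  then have 1: "f \<in> scaled_A 1"
    by (intro PL_normalizer_trivial_scale) (auto simp: kernel_def semidirect_simps quotient_simps)
  then show "f \<in> B_R n"
    using f by (simp add: B_R_eq kernel_def semidirect_simps
        shift_and_scale_eq[OF prime_divisors_group_closed(1)])
next
  fix f assume "f \<in> B_R n"
  then show "f \<in> kernel auts extension shift_and_scale"
    using prime_divisors_group_closed(1)
    by (auto simp: B_R_eq kernel_def semidirect_simps quotient_simps PL_normalizer_def
        shift_and_scale_eq[OF prime_divisors_group_closed(1)])
qed

lemma group_auts: "group auts"
  using group.subgroup_imp_group[OF group_HomeoR subgroup_PL_normalizer] .

lemma B_normal: "B_R n \<lhd> auts" and B_quotient: "auts Mod B_R n \<cong> extension"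
  using group.iso_quotient_of_surjective_hom[OF group_auts shift_and_scale_hom,
      OF shift_and_scale_onto shift_and_scale_one]
  by (simp_all only: kernel_shift_and_scale)

lemma A_normal: "A_R n \<lhd> auts" and A_quotient: "auts Mod A_R n \<cong> prime_divisors_quotient n"
proof -
  have "snd \<in> hom extension (prime_divisors_quotient n)"
    by (rule homI) (auto simp: semidirect_product_def)
  then have hom: "snd \<circ> shift_and_scale \<in> hom auts (prime_divisors_quotient n)"
    using hom_compose[OF shift_and_scale_hom] by blast
  have "0 \<in> carrier (integer_mod_group (n - 1))" by simp
  then have "snd ` carrier extension = carrier (prime_divisors_quotient n)"
    unfolding semidirect_simps by (metis empty_iff snd_image_times)
  then have onto: "(snd \<circ> shift_and_scale) ` carrier auts = carrier (prime_divisors_quotient n)"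
    by (simp only: image_comp[symmetric] shift_and_scale_onto)
  have one: "(snd \<circ> shift_and_scale) \<one>\<^bsub>auts\<^esub> = \<one>\<^bsub>prime_divisors_quotient n\<^esub>"
    by (simp only: o_apply shift_and_scale_one semidirect_simps snd_conv)
  show "A_R n \<lhd> auts" "auts Mod A_R n \<cong> prime_divisors_quotient n"
    using group.iso_quotient_of_surjective_hom[OF group_auts hom, OF onto one] by (simp_all only: kernel_scale)
qed

text \<open>Only conjugates of elements of \<open>B_R n\<close>, and only their membership in \<open>A_R n\<close>, enter the proof
  that \<open>h\<close> lies in \<open>PL_normalizer\<close>; so one argument covers both groups.\<close>

lemma Aut_PL_eq_PL_normalizer:
  assumes "B_R n \<subseteq> C" "C \<subseteq> A_R n" "C \<lhd> auts"
  shows "Aut_PL C = PL_normalizer"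
proof (intro equalityI subsetI)
  have C: "C \<subseteq> carrier HomeoR" using assms(2) by (auto simp: A_R_def)
  fix h assume "h \<in> Aut_PL C"
  then have norm: "h \<in> normalizer HomeoR C" and h: "PL h" "strict_mono h" by (auto simp: Aut_PL_def)
  then have hH: "h \<in> carrier HomeoR" using group.mem_normalizer_iff[OF group_HomeoR C] by blast
  have "h \<circ> f \<circ> inv_into UNIV h \<in> A_R n" "inv_into UNIV h \<circ> f \<circ> h \<in> A_R n" if "f \<in> B_R n" for f
  proof -
    have "f \<in> C" using that assms(1) by blast
    then show "h \<circ> f \<circ> inv_into UNIV h \<in> A_R n" "inv_into UNIV h \<circ> f \<circ> h \<in> A_R n"
      using group.normalizer_conjugates[OF group_HomeoR C norm] assms(2)
      by (auto simp: HomeoR_m_inv[OF hH] o_assoc)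
  qed
  then obtain s where "s \<in> prime_divisors_group n" "h \<in> scaled_A s"
    using scaled_A_if_normalizes[OF hH h(2,1)] by metis
  then show "h \<in> PL_normalizer" by (auto simp: PL_normalizer_def)
next
  fix h assume h: "h \<in> PL_normalizer"
  then have "h \<in> normalizer HomeoR C"
    using group.normal_subset_normalizer[OF group_HomeoR subgroup_PL_normalizer assms(3)] by blast
  then show "h \<in> Aut_PL C" using h by (auto simp: Aut_PL_def PL_normalizer_def scaled_A_def)
qed

end

theorem theorem6p1p4:
  fixes n :: nat
  assumes "n \<ge> 2"
  shows "Aut_PL (A_R n) = Aut_PL (B_R n)
       \<and> Out_PL (A_R n) \<cong> prime_divisors_quotient n
       \<and> Out_PL (B_R n) \<cong>
           semidirect_product (integer_mod_group (n - 1)) (prime_divisors_quotient n)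
             (coset_action n)"
proof -
  have sub: "B_R n \<subseteq> A_R n" using A_R_eq_scaled_A[OF assms] B_R_eq[OF assms] by blast
  have "Aut_PL (A_R n) = PL_normalizer n"
    using Aut_PL_eq_PL_normalizer[OF assms sub order_refl A_normal[OF assms]] .
  moreover have "Aut_PL (B_R n) = PL_normalizer n"
    using Aut_PL_eq_PL_normalizer[OF assms order_refl sub B_normal[OF assms]] .
  ultimately show ?thesis
    unfolding Out_PL_def using A_quotient[OF assms] B_quotient[OF assms] by simp
qed

end
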